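(* Let $(\mathcal H, \langle \cdot, \cdot \rangle_{\mathcal H})$ and $(\mathcal V, \langle \cdot, \cdot \rangle_{\mathcal V})$ be any real separable Hilbert spaces, and let $\eta:=\frac{\pi}{2}+18\sqrt{2e}$. Then: (i) The norms $\|\cdot\|_{\mathcal G(2,1)(\mathcal V)}$ and $\|\cdot\|_{\mathcal D(2,1)(\mathcal V)}$ are equivalent. More precisely, for all $F\in\mathcal S_{\mathcal V}$, $$\|F\|_{\mathcal G(2,1)(\mathcal V)}\le\|F\|_{\mathcal D(2,1)(\mathcal V)}\le(1+\eta)\,\|F\|_{\mathcal G(2,1)(\mathcal V)}.$$ (ii) For any integer $k\ge3$ and all $F\in\mathcal S_{\mathcal V}$, $$\|F\|_{\mathcal D(k,1)(\mathcal V)}\le(1+2\eta)\left(\|F\|_{\mathcal G(k,1)(\mathcal V)}+\sum_{\ell=1}^{\lceil k/2\rceil-1}\left\|D^{2\ell}F\right\|_{L^1(\Omega;\mathcal H^{\otimes2\ell}\otimes\mathcal V)}\right)$$ and $$\|F\|_{\mathcal D(k,1)(\mathcal V)}\le(1+2\eta)\left(\|F\|_{\mathcal G(k,1)(\mathcal V)}+\sum_{\ell=1}^{\lfloor k/2\rfloor}\left\|D^{2\ell-1}F\right\|_{L^1(\Omega;\mathcal H^{\otimes(2\ell-1)}\otimes\mathcal V)}\right).$$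
   Context: Setting. An isonormal Gaussian process over a real separable Hilbert space $\mathcal H$ is a centered Gaussian family $W=\{W(h):h\in\mathcal H\}$ of real random variables on a probability space $(\Omega,\mathcal F,\mathbb P)$ with $\mathbb E[W(h)W(g)]=\langle h,g\rangle_{\mathcal H}$ for all $h,g\in\mathcal H$. Throughout such a $W$ is fixed and $\mathcal F$ is the $\sigma$-field generated by $\{W(h):h\in\mathcal H\}$. $\mathcal S$ is the set of random variables $F=f(W(h_1),\dots,W(h_m))$ with $m\ge1$, $h_1,\dots,h_m\in\mathcal H$ and $f\in C^\infty(\mathbb R^m)$ such that $f$ and all its partial derivatives have at most polynomial growth. For an integer $k\ge1$, the $k$-th Malliavin derivative of such $F$ is the $\mathcal H^{\otimes k}$-valued random variable $$D^kF:=\sum_{i_1,\dots,i_k=1}^m\frac{\partial^k f}{\partial x_{i_1}\cdots\partial x_{i_k}}(W(h_1),\dots,W(h_m))\,h_{i_1}\otimes\cdots\otimes h_{i_k}$$ (independent of the chosen representation). $\mathcal S_{\mathcal V}$ is the set of $\mathcal V$-valued random variables $F=\sum_{j=1}^J F_j v_j$ with $J\ge 1$, $F_j\in\mathcal S$, $v_j\in\mathcal V$; for such $F$, $D^kF:=\sum_{j=1}^J(D^kF_j)\otimes v_j$, which takes values in the Hilbert tensor product $\mathcal H^{\otimes k}\otimes\mathcal V$. For a real separable Hilbert space $\mathcal K$, $\|G\|_{L^1(\Omega;\mathcal K)}:=\mathbb E[\|G\|_{\mathcal K}]$. The graph norm and the full Sobolev norm (for exponent $1$) are $$\|F\|_{\mathcal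 G(k,1)(\mathcal V)}:=\|F\|_{L^1(\Omega;\mathcal V)}+\|D^kF\|_{L^1(\Omega;\mathcal H^{\otimes k}\otimes\mathcal V)},$$ $$\|F\|_{\mathcal D(k,1)(\mathcal V)}:=\|F\|_{L^1(\Omega;\mathcal V)}+\sum_{\ell=1}^k\|D^\ell F\|_{L^1(\Omega;\mathcal H^{\otimes\ell}\otimes\mathcal V)}.$$ *)

theory Defs
  imports "HOL-Probability.Probability"
begin

section \<open>Square-summable families\<close>

typedef (overloaded) ('i, 'v::real_inner) ell2 =
  "{f :: 'i \<Rightarrow> 'v. (\<lambda>i. (norm (f i))\<^sup>2) summable_on UNIV}"
  morphisms ell2_nth Abs_ell2
  by (rule exI[of _ "\<lambda>_. 0"]) simp

setup_lifting type_definition_ell2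

lemma ell2_summable_add:
  fixes f g :: "'i \<Rightarrow> 'v::real_inner"
  assumes "(\<lambda>i. (norm (f i))\<^sup>2) summable_on UNIV" "(\<lambda>i. (norm (g i))\<^sup>2) summable_on UNIV"
  shows "(\<lambda>i. (norm (f i + g i))\<^sup>2) summable_on UNIV"
proof (rule summable_on_comparison_test)
  show "(\<lambda>i. 2 * ((norm (f i))\<^sup>2 + (norm (g i))\<^sup>2)) summable_on UNIV"
    using assms by (intro summable_on_cmult_right summable_on_add)
  show "(norm (f i + g i))\<^sup>2 \<le> 2 * ((norm (f i))\<^sup>2 + (norm (g i))\<^sup>2)" for i
  proof -
    have "(norm (f i + g i))\<^sup>2 + (norm (f i - g i))\<^sup>2 = 2 * ((norm (f i))\<^sup>2 + (norm (g i))\<^sup>2)"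
      by (simp add: power2_norm_eq_inner inner_simps inner_commute)
    moreover have "0 \<le> (norm (f i - g i))\<^sup>2" by simp
    ultimately show ?thesis by linarith
  qed
qed simp

lemma ell2_summable_scaleR:
  fixes f :: "'i \<Rightarrow> 'v::real_inner"
  assumes "(\<lambda>i. (norm (f i))\<^sup>2) summable_on UNIV"
  shows "(\<lambda>i. (norm (c *\<^sub>R f i))\<^sup>2) summable_on UNIV"
  using summable_on_cmult_right[OF assms, of "c\<^sup>2"] by (simp add: power_mult_distrib)

lemma ell2_summable_inner:
  fixes f g :: "'i \<Rightarrow> 'v::real_inner"
  assumes "(\<lambda>i. (norm (f i))\<^sup>2) summable_on UNIV" "(\<lambda>i. (norm (g i))\<^sup>2) summable_on UNIV"
  shows "(\<lambda>i. f i \<bullet> g i) summable_on UNIV"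
proof -
  have "(\<lambda>i. norm (f i \<bullet> g i)) summable_on UNIV"
  proof (rule Infinite_Sum.abs_summable_on_comparison_test')
    show "(\<lambda>i. (norm (f i))\<^sup>2 + (norm (g i))\<^sup>2) summable_on UNIV"
      using assms by (rule summable_on_add)
    show "norm (f i \<bullet> g i) \<le> (norm (f i))\<^sup>2 + (norm (g i))\<^sup>2" for i
    proof -
      have "norm (f i \<bullet> g i) \<le> norm (f i) * norm (g i)"
        by (simp add: Cauchy_Schwarz_ineq2)
      also have "\<dots> \<le> (norm (f i))\<^sup>2 + (norm (g i))\<^sup>2"
      proof -
        have "0 \<le> norm (f i) * norm (g i)" by simp
        with sum_squares_bound[of "norm (f i)" "norm (g i)"] show ?thesis by linarith
      qed
      finally show ?thesis .
    qed
  qed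
  then show ?thesis by (rule abs_summable_summable)
qed

instantiation ell2 :: (type, real_inner) real_vector
begin
lift_definition zero_ell2 :: "('a, 'b) ell2" is "\<lambda>_. 0" by simp
lift_definition plus_ell2 :: "('a, 'b) ell2 \<Rightarrow> ('a, 'b) ell2 \<Rightarrow> ('a, 'b) ell2"
  is "\<lambda>f g i. f i + g i" by (rule ell2_summable_add)
lift_definition uminus_ell2 :: "('a, 'b) ell2 \<Rightarrow> ('a, 'b) ell2" is "\<lambda>f i. - f i" by simp
lift_definition minus_ell2 :: "('a, 'b) ell2 \<Rightarrow> ('a, 'b) ell2 \<Rightarrow> ('a, 'b) ell2"
  is "\<lambda>f g i. f i - g i"
  subgoal for f g using ell2_summable_add[of f "\<lambda>i. - g i"] by simp
  done
lift_definition scaleR_ell2 :: "real \<Rightarrow> ('a, 'b) ell2 \<Rightarrow> ('a, 'b) ell2"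
  is "\<lambda>c f i. c *\<^sub>R f i" by (rule ell2_summable_scaleR)
instance by standard (transfer; simp add: algebra_simps fun_eq_iff)+
end

instantiation ell2 :: (type, real_inner) real_inner
begin
lift_definition inner_ell2 :: "('a, 'b) ell2 \<Rightarrow> ('a, 'b) ell2 \<Rightarrow> real"
  is "\<lambda>f g. \<Sum>\<^sub>\<infinity>i. f i \<bullet> g i" .
definition norm_ell2 :: "('a, 'b) ell2 \<Rightarrow> real" where "norm_ell2 x = sqrt (x \<bullet> x)"
definition sgn_ell2 :: "('a, 'b) ell2 \<Rightarrow> ('a, 'b) ell2" where "sgn_ell2 x = x /\<^sub>R norm x"
definition dist_ell2 :: "('a, 'b) ell2 \<Rightarrow> ('a, 'b) ell2 \<Rightarrow> real"
  where "dist_ell2 x y = norm (x - y)"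
definition uniformity_ell2 :: "(('a, 'b) ell2 \<times> ('a, 'b) ell2) filter"
  where "uniformity_ell2 = (INF e\<in>{0<..}. principal {(x, y). dist x y < e})"
definition open_ell2 :: "('a, 'b) ell2 set \<Rightarrow> bool"
  where "open_ell2 U \<longleftrightarrow> (\<forall>x\<in>U. eventually (\<lambda>(x', y). x' = x \<longrightarrow> y \<in> U) uniformity)"
instance
proof
  fix x y z :: "('a, 'b) ell2" and r :: real and U :: "('a, 'b) ell2 set"
  show "x \<bullet> y = y \<bullet> x" by transfer (simp add: inner_commute)
  show "(x + y) \<bullet> z = x \<bullet> z + y \<bullet> z"
    by transfer (simp add: inner_add_left infsum_add ell2_summable_inner)
  show "(r *\<^sub>R x) \<bullet> y = r * (x \<bullet> y)"
    by transfer (simp add: infsum_cmult_right')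
  show "0 \<le> x \<bullet> x" by transfer (simp add: infsum_nonneg)
  show "x \<bullet> x = 0 \<longleftrightarrow> x = 0"
  proof
    assume "x \<bullet> x = 0"
    then show "x = 0"
    proof transfer
      fix f :: "'a \<Rightarrow> 'b"
      assume f: "(\<lambda>i. (norm (f i))\<^sup>2) summable_on UNIV" and 0: "(\<Sum>\<^sub>\<infinity>i. f i \<bullet> f i) = 0"
      have "f i \<bullet> f i = 0" for i
        by (rule nonneg_infsum_le_0D[where A = UNIV])
          (use f 0 in \<open>auto simp: power2_norm_eq_inner\<close>)
      then show "f = (\<lambda>_. 0)" by auto
    qed
  qed (transfer; simp)
qed (simp_all add: norm_ell2_def sgn_ell2_def dist_ell2_def uniformity_ell2_def open_ell2_def)
end

lemma inner_ell2_eq: "x \<bullet> y = (\<Sum>\<^sub>\<infinity>i. ell2_nth x i \<bullet> ell2_nth y i)"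
  by transfer simp

lemma has_sum_norm_ell2: "((\<lambda>i. (norm (ell2_nth x i))\<^sup>2) has_sum (norm x)\<^sup>2) UNIV"
  unfolding power2_norm_eq_inner
  by transfer (simp add: power2_norm_eq_inner)

lemma norm_ell2_finite_le:
  assumes "finite A" shows "(\<Sum>i\<in>A. (norm (ell2_nth x i))\<^sup>2) \<le> (norm x)\<^sup>2"
  using finite_sum_le_has_sum[OF has_sum_norm_ell2 assms, of x] by simp

lemma norm_ell2_nth_le: "norm (ell2_nth x i) \<le> norm x"
  using norm_ell2_finite_le[of "{i}" x] by (simp add: power2_le_iff_abs_le)

instance ell2 :: (type, "{real_inner, complete_space}") complete_space
proof
  fix X :: "nat \<Rightarrow> ('a, 'b) ell2"
  assume X: "Cauchy X"
  have "Cauchy (\<lambda>n. ell2_nth (X n) i)" for i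
    unfolding Cauchy_def
  proof (intro allI impI)
    fix e :: real assume "e > 0"
    then obtain N where N: "\<forall>m\<ge>N. \<forall>n\<ge>N. dist (X m) (X n) < e"
      using X unfolding Cauchy_def by blast
    have "dist (ell2_nth (X m) i) (ell2_nth (X n) i) \<le> dist (X m) (X n)" for m n
      using norm_ell2_nth_le[of "X m - X n" i] by (simp add: dist_norm minus_ell2.rep_eq)
    then show "\<exists>M. \<forall>m\<ge>M. \<forall>n\<ge>M. dist (ell2_nth (X m) i) (ell2_nth (X n) i) < e"
      using N by (meson le_less_trans)
  qed
  then have "\<exists>l. (\<lambda>n. ell2_nth (X n) i) \<longlonglongrightarrow> l" for i
    using Cauchy_convergent_iff convergent_def by blast
  then obtain g where g: "\<And>i. (\<lambda>n. ell2_nth (X n) i) \<longlonglongrightarrow> g i" by metis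
  have fin: "\<exists>N. \<forall>n\<ge>N. \<forall>A. finite A \<longrightarrow> (\<Sum>i\<in>A. (norm (ell2_nth (X n) i - g i))\<^sup>2) \<le> e\<^sup>2"
    if "e > 0" for e :: real
  proof -
    obtain N where N: "\<forall>m\<ge>N. \<forall>n\<ge>N. dist (X m) (X n) < e"
      using X \<open>e > 0\<close> unfolding Cauchy_def by blast
    have "(\<Sum>i\<in>A. (norm (ell2_nth (X n) i - g i))\<^sup>2) \<le> e\<^sup>2" if "n \<ge> N" "finite A" for n A
    proof (rule LIMSEQ_le_const2)
      show "(\<lambda>m. \<Sum>i\<in>A. (norm (ell2_nth (X n) i - ell2_nth (X m) i))\<^sup>2)
          \<longlonglongrightarrow> (\<Sum>i\<in>A. (norm (ell2_nth (X n) i - g i))\<^sup>2)"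
        by (intro tendsto_intros g)
      have "(\<Sum>i\<in>A. (norm (ell2_nth (X n) i - ell2_nth (X m) i))\<^sup>2) \<le> e\<^sup>2" if "m \<ge> N" for m
      proof -
        have "(\<Sum>i\<in>A. (norm (ell2_nth (X n) i - ell2_nth (X m) i))\<^sup>2) \<le> (norm (X n - X m))\<^sup>2"
          using norm_ell2_finite_le[OF \<open>finite A\<close>, of "X n - X m"] by (simp add: minus_ell2.rep_eq)
        also have "\<dots> \<le> e\<^sup>2"
          using N \<open>n \<ge> N\<close> \<open>m \<ge> N\<close> by (intro power_mono) (auto simp: dist_norm intro: less_imp_le)
        finally show ?thesis .
      qed
      then show "\<exists>M. \<forall>m\<ge>M. (\<Sum>i\<in>A. (norm (ell2_nth (X n) i - ell2_nth (X m) i))\<^sup>2) \<le> e\<^sup>2"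
        by blast
    qed
    then show ?thesis by blast
  qed
  have summ: "(\<lambda>i. (norm (f i))\<^sup>2) summable_on UNIV"
    if "\<forall>A. finite A \<longrightarrow> (\<Sum>i\<in>A. (norm (f i))\<^sup>2) \<le> c" for c and f :: "'a \<Rightarrow> 'b"
    by (rule nonneg_bdd_above_summable_on) (use that in \<open>auto simp: bdd_above_def\<close>)
  have "(\<lambda>i. (norm (g i))\<^sup>2) summable_on UNIV"
  proof -
    obtain n where n: "\<forall>A. finite A \<longrightarrow> (\<Sum>i\<in>A. (norm (ell2_nth (X n) i - g i))\<^sup>2) \<le> 1\<^sup>2"
      using fin[of 1] by auto
    have "(\<lambda>i. (norm (- (ell2_nth (X n) i - g i)))\<^sup>2) summable_on UNIV"
      using summ[OF n] by (simp add: norm_minus_commute)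
    from ell2_summable_add[OF has_sum_imp_summable[OF has_sum_norm_ell2[of "X n"]] this]
    show ?thesis by simp
  qed
  then have G: "ell2_nth (Abs_ell2 g) = g" by (simp add: Abs_ell2_inverse)
  have "X \<longlonglongrightarrow> Abs_ell2 g"
  proof (rule metric_LIMSEQ_I)
    fix e :: real assume "e > 0"
    then obtain N where N: "\<forall>n\<ge>N. \<forall>A. finite A \<longrightarrow>
        (\<Sum>i\<in>A. (norm (ell2_nth (X n) i - g i))\<^sup>2) \<le> (e/2)\<^sup>2"
      using fin[of "e/2"] by auto
    have "dist (X n) (Abs_ell2 g) < e" if "n \<ge> N" for n
    proof -
      have "(norm (X n - Abs_ell2 g))\<^sup>2 \<le> (e/2)\<^sup>2"
        by (rule has_sum_le_finite_sums[OF has_sum_norm_ell2])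
          (use N that in \<open>simp add: minus_ell2.rep_eq G\<close>)
      then have "norm (X n - Abs_ell2 g) \<le> e/2"
        using \<open>e > 0\<close> by (simp add: power2_le_iff_abs_le)
      then show ?thesis using \<open>e > 0\<close> by (simp add: dist_norm)
    qed
    then show "\<exists>no. \<forall>n\<ge>no. dist (X n) (Abs_ell2 g) < e" by blast
  qed
  then show "convergent X" by (auto simp: convergent_def)
qed


section \<open>Orthonormal bases of separable inner product spaces\<close>

definition orthonormal :: "'h::real_inner set \<Rightarrow> bool" where
  "orthonormal B \<longleftrightarrow> (\<forall>x\<in>B. \<forall>y\<in>B. x \<bullet> y = (if x = y then 1 else 0))"

definition orthonormal_basis :: "'h::real_inner set \<Rightarrow> bool" where
  "orthonormal_basis B \<longleftrightarrow> orthonormal B \<and> closure (span B) = UNIV"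

lemma orthonormal_inner_sum:
  assumes "orthonormal B" "finite A" "A \<subseteq> B" "a \<in> B"
  shows "a \<bullet> (\<Sum>e\<in>A. u e *\<^sub>R e) = (if a \<in> A then u a else 0)"
proof -
  have "a \<bullet> (\<Sum>e\<in>A. u e *\<^sub>R e) = (\<Sum>e\<in>A. if e = a then u e else 0)"
    unfolding inner_sum_right
    by (rule sum.cong) (use assms in \<open>auto simp: orthonormal_def subset_iff\<close>)
  then show ?thesis using assms by (simp add: sum.delta)
qed

lemma orthonormal_norm_diff:
  assumes "orthonormal B" "finite A" "A \<subseteq> B"
  shows "(norm (x - (\<Sum>e\<in>A. u e *\<^sub>R e)))\<^sup>2
    = (norm x)\<^sup>2 - (\<Sum>e\<in>A. (x \<bullet> e)\<^sup>2) + (\<Sum>e\<in>A. (u e - x \<bullet> e)\<^sup>2)"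
proof -
  let ?s = "\<Sum>e\<in>A. u e *\<^sub>R e"
  have "?s \<bullet> ?s = (\<Sum>e\<in>A. u e * (e \<bullet> ?s))"
    by (subst inner_sum_left) simp
  also have "\<dots> = (\<Sum>e\<in>A. (u e)\<^sup>2)"
    by (rule sum.cong)
      (use assms in \<open>auto simp: orthonormal_inner_sum subset_iff power2_eq_square\<close>)
  finally have ss: "?s \<bullet> ?s = (\<Sum>e\<in>A. (u e)\<^sup>2)" .
  have xs: "x \<bullet> ?s = (\<Sum>e\<in>A. u e * (x \<bullet> e))" by (simp add: inner_sum_right)
  have "(norm (x - ?s))\<^sup>2 = (norm x)\<^sup>2 - 2 * (x \<bullet> ?s) + ?s \<bullet> ?s"
    by (simp only: power2_norm_eq_inner inner_diff_left inner_diff_right inner_commute[of ?s x])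
  then show ?thesis
    by (simp add: ss xs power2_diff sum.distrib sum_subtractf sum_distrib_left mult_ac)
qed

lemma orthonormal_basis_exists:
  "\<exists>B :: 'h::{real_inner, second_countable_topology} set. orthonormal_basis B"
proof -
  obtain D :: "'h set" where D: "countable D" "\<And>X. open X \<Longrightarrow> X \<noteq> {} \<Longrightarrow> \<exists>d\<in>D. d \<in> X"
    using countable_dense_setE by metis
  have "D \<noteq> {}" using D(2)[of UNIV] by auto
  define d where "d = from_nat_into D"
  define r where "r E x = x - (\<Sum>e\<in>E. (x \<bullet> e) *\<^sub>R e)" for E :: "'h set" and x
  define E where "E = rec_nat ({} :: 'h set)
    (\<lambda>n A. if r A (d n) = 0 then A else insert (sgn (r A (d n))) A)"
  have E0: "E 0 = {}" by (simp add: E_def)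
  have ES: "E (Suc n) = (if r (E n) (d n) = 0 then E n else insert (sgn (r (E n) (d n))) (E n))" for n
    by (simp add: E_def)
  have inv: "finite (E n) \<and> orthonormal (E n)" for n
  proof (induction n)
    case 0 then show ?case by (simp add: E0 orthonormal_def)
  next
    case (Suc n)
    have "e \<bullet> r (E n) (d n) = 0" if "e \<in> E n" for e
      using Suc that unfolding r_def inner_diff_right
      by (subst orthonormal_inner_sum[of "E n"]) (auto simp: inner_commute)
    then have "e \<bullet> sgn (r (E n) (d n)) = 0" "sgn (r (E n) (d n)) \<bullet> e = 0" if "e \<in> E n" for e
      using that by (auto simp: sgn_div_norm inner_commute)
    moreover have "sgn (r (E n) (d n)) \<bullet> sgn (r (E n) (d n)) = 1" if "r (E n) (d n) \<noteq> 0"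
      using that by (simp add: norm_sgn flip: power2_norm_eq_inner)
    ultimately show ?case using Suc by (auto simp: ES orthonormal_def)
  qed
  have mono: "E m \<subseteq> E n" if "m \<le> n" for m n
    using that by (rule lift_Suc_mono_le[rotated]) (auto simp: ES)
  define B where "B = (\<Union>n. E n)"
  have "orthonormal B"
    unfolding orthonormal_def
  proof (intro ballI)
    fix x y assume "x \<in> B" "y \<in> B"
    then obtain m n where "x \<in> E m" "y \<in> E n" by (auto simp: B_def)
    then have "x \<in> E (max m n)" "y \<in> E (max m n)"
      using mono[of m "max m n"] mono[of n "max m n"] by auto
    then show "x \<bullet> y = (if x = y then 1 else 0)"
      using inv[of "max m n"] by (auto simp: orthonormal_def)
  qed
  moreover have "d n \<in> span B" for n
  proof -
    have sum: "(\<Sum>e\<in>E n. (d n \<bullet> e) *\<^sub>R e) \<in> span B"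
      by (intro span_sum span_scale span_base) (auto simp: B_def)
    have "r (E n) (d n) \<in> span B"
    proof (cases "r (E n) (d n) = 0")
      case False
      then have "sgn (r (E n) (d n)) \<in> E (Suc n)" by (simp add: ES)
      then have "sgn (r (E n) (d n)) \<in> span B" by (auto intro: span_base simp: B_def)
      then have "norm (r (E n) (d n)) *\<^sub>R sgn (r (E n) (d n)) \<in> span B" by (rule span_scale)
      then show ?thesis using False by (simp add: sgn_div_norm)
    qed (simp add: span_zero)
    from span_add[OF this sum] show ?thesis by (simp add: r_def)
  qed
  then have "D \<subseteq> span B"
    using D(1) \<open>D \<noteq> {}\<close> unfolding d_def by (metis from_nat_into_surj subsetI)
  have "closure (span B) = UNIV"
  proof (rule ccontr)
    assume "closure (span B) \<noteq> UNIV"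
    then have "- closure (span B) \<noteq> {}" by auto
    then obtain x where "x \<in> D" "x \<in> - closure (span B)"
      using D(2)[of "- closure (span B)"] by auto
    then show False using \<open>D \<subseteq> span B\<close> closure_subset by blast
  qed
  ultimately show ?thesis by (auto simp: orthonormal_basis_def)
qed

lemma orthonormal_basis_parseval_norm:
  assumes "orthonormal_basis B"
  shows "((\<lambda>e. (x \<bullet> e)\<^sup>2) has_sum (norm x)\<^sup>2) B"
proof -
  have B: "orthonormal B" "closure (span B) = UNIV"
    using assms by (auto simp: orthonormal_basis_def)
  have le: "(\<Sum>e\<in>A. (x \<bullet> e)\<^sup>2) \<le> (norm x)\<^sup>2" if "finite A" "A \<subseteq> B" for A
  proof -
    have "0 \<le> (norm (x - (\<Sum>e\<in>A. (x \<bullet> e) *\<^sub>R e)))\<^sup>2" by simp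
    then show ?thesis unfolding orthonormal_norm_diff[OF B(1) that] by simp
  qed
  have summ: "(\<lambda>e. (x \<bullet> e)\<^sup>2) summable_on B"
    by (rule nonneg_bdd_above_summable_on) (use le in \<open>auto simp: bdd_above_def\<close>)
  have "infsum (\<lambda>e. (x \<bullet> e)\<^sup>2) B \<le> (norm x)\<^sup>2"
    using summ le by (rule infsum_le_finite_sums)
  moreover have "(norm x)\<^sup>2 \<le> infsum (\<lambda>e. (x \<bullet> e)\<^sup>2) B"
  proof (rule field_le_epsilon)
    fix \<epsilon> :: real assume "\<epsilon> > 0"
    have "x \<in> closure (span B)" by (simp add: B)
    then obtain s where s: "s \<in> span B" "dist s x < sqrt \<epsilon>"
      using \<open>\<epsilon> > 0\<close> unfolding closure_approachable by (meson real_sqrt_gt_zero)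
    obtain A u where A: "finite A" "A \<subseteq> B" and s_eq: "s = (\<Sum>e\<in>A. u e *\<^sub>R e)"
      using s(1) unfolding span_explicit by blast
    have "(norm (x - s))\<^sup>2 \<le> \<epsilon>"
      using s(2) power_mono[of "norm (x - s)" "sqrt \<epsilon>" 2] \<open>\<epsilon> > 0\<close>
      by (simp add: dist_norm norm_minus_commute)
    moreover have "(norm x)\<^sup>2 - (\<Sum>e\<in>A. (x \<bullet> e)\<^sup>2) \<le> (norm (x - s))\<^sup>2"
      unfolding s_eq orthonormal_norm_diff[OF B(1) A] by (simp add: sum_nonneg)
    moreover have "(\<Sum>e\<in>A. (x \<bullet> e)\<^sup>2) \<le> infsum (\<lambda>e. (x \<bullet> e)\<^sup>2) B"
      using summ A by (intro finite_sum_le_infsum) auto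
    ultimately show "(norm x)\<^sup>2 \<le> infsum (\<lambda>e. (x \<bullet> e)\<^sup>2) B + \<epsilon>" by linarith
  qed
  ultimately show ?thesis using summ by (simp add: has_sum_iff)
qed

lemma orthonormal_basis_parseval:
  assumes "orthonormal_basis B"
  shows "((\<lambda>e. (x \<bullet> e) * (y \<bullet> e)) has_sum (x \<bullet> y)) B"
proof -
  have "((\<lambda>e. 1/4 * (((x + y) \<bullet> e)\<^sup>2 + (-1) * ((x - y) \<bullet> e)\<^sup>2))
      has_sum (1/4 * ((norm (x + y))\<^sup>2 + (-1) * (norm (x - y))\<^sup>2))) B"
    by (intro has_sum_cmult_right has_sum_add orthonormal_basis_parseval_norm assms)
  moreover have "1/4 * (((x + y) \<bullet> e)\<^sup>2 + (-1) * ((x - y) \<bullet> e)\<^sup>2) = (x \<bullet> e) * (y \<bullet> e)" for e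
    by (simp add: inner_simps power2_eq_square algebra_simps)
  moreover have "1/4 * ((norm (x + y))\<^sup>2 + (-1) * (norm (x - y))\<^sup>2) = x \<bullet> y"
    by (simp add: power2_norm_eq_inner inner_simps inner_commute)
  ultimately show ?thesis by simp
qed

lemma has_sum_product_real:
  fixes f :: "'a \<Rightarrow> real" and g :: "'b \<Rightarrow> real"
  assumes f: "(f has_sum s) A" and g: "(g has_sum t) B"
  shows "((\<lambda>(x, y). f x * g y) has_sum (s * t)) (A \<times> B)"
proof (rule has_sum_SigmaI)
  show "((\<lambda>y. case (x, y) of (x, y) \<Rightarrow> f x * g y) has_sum (f x * t)) B" for x
    using has_sum_cmult_right[OF g] by simp
  show "((\<lambda>x. f x * t) has_sum (s * t)) A"
    using f by (rule has_sum_cmult_left)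
  have fa: "(\<lambda>x. \<bar>f x\<bar>) summable_on A" and ga: "(\<lambda>x. \<bar>g x\<bar>) summable_on B"
    using summable_on_iff_abs_summable_on_real[THEN iffD1, OF has_sum_imp_summable[OF f]]
      summable_on_iff_abs_summable_on_real[THEN iffD1, OF has_sum_imp_summable[OF g]] by simp_all
  have "(\<lambda>p. norm (case p of (x, y) \<Rightarrow> f x * g y)) summable_on A \<times> B"
  proof (rule nonneg_bdd_above_summable_on)
    have "(\<Sum>p\<in>F. norm (case p of (x, y) \<Rightarrow> f x * g y))
        \<le> infsum (\<lambda>x. \<bar>f x\<bar>) A * infsum (\<lambda>x. \<bar>g x\<bar>) B" if "finite F" "F \<subseteq> A \<times> B" for F
    proof -
      have "(\<Sum>p\<in>F. norm (case p of (x, y) \<Rightarrow> f x * g y))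
          \<le> (\<Sum>p\<in>fst ` F \<times> snd ` F. norm (case p of (x, y) \<Rightarrow> f x * g y))"
        using that by (intro sum_mono2) force+
      also have "\<dots> = (\<Sum>x\<in>fst ` F. \<bar>f x\<bar>) * (\<Sum>y\<in>snd ` F. \<bar>g y\<bar>)"
        by (simp add: sum_product sum.cartesian_product abs_mult case_prod_unfold)
      also have "\<dots> \<le> infsum (\<lambda>x. \<bar>f x\<bar>) A * infsum (\<lambda>x. \<bar>g x\<bar>) B"
        using that fa ga
        by (intro mult_mono finite_sum_le_infsum sum_nonneg infsum_nonneg) auto
      finally show ?thesis .
    qed
    then show "bdd_above (sum (\<lambda>p. norm (case p of (x, y) \<Rightarrow> f x * g y)) ` {F. F \<subseteq> A \<times> B \<and> finite F})"
      unfolding bdd_above_def by blast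
  qed simp
  then show "(\<lambda>(x, y). f x * g y) summable_on A \<times> B" by (rule abs_summable_summable)
qed

lemma orthonormal_basis_parseval_list:
  assumes B: "orthonormal_basis B" and "length gs = length hs"
  shows "((\<lambda>es. (\<Prod>i<length hs. hs ! i \<bullet> es ! i) * (\<Prod>i<length hs. gs ! i \<bullet> es ! i))
    has_sum (\<Prod>i<length hs. hs ! i \<bullet> gs ! i)) {es. set es \<subseteq> B \<and> length es = length hs}"
  using assms(2)
proof (induction hs arbitrary: gs)
  case Nil
  have "{es. set es \<subseteq> B \<and> length es = length []} = {[]}" by auto
  then show ?case using Nil by (simp add: has_sum_finite_iff)
next
  case (Cons h hs)
  then obtain g gs' where gs: "gs = g # gs'" "length gs' = length hs"
    by (cases gs) auto
  let ?S = "{es. set es \<subseteq> B \<and> length es = length hs}"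
  let ?T = "{es. set es \<subseteq> B \<and> length es = length (h # hs)}"
  let ?c = "\<lambda>(e, es). e # es"
  have img: "?T = ?c ` (B \<times> ?S)"
  proof (intro equalityI subsetI)
    fix es assume "es \<in> ?T"
    then show "es \<in> ?c ` (B \<times> ?S)" by (cases es) auto
  qed auto
  have "inj_on ?c (B \<times> ?S)" by (auto simp: inj_on_def)
  moreover have "((\<lambda>(e, es). ((h \<bullet> e) * (g \<bullet> e))
      * ((\<Prod>i<length hs. hs ! i \<bullet> es ! i) * (\<Prod>i<length hs. gs' ! i \<bullet> es ! i)))
      has_sum ((h \<bullet> g) * (\<Prod>i<length hs. hs ! i \<bullet> gs' ! i))) (B \<times> ?S)"
    by (intro has_sum_product_real orthonormal_basis_parseval B Cons.IH gs(2))
  ultimately show ?case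
    unfolding img by (simp add: has_sum_reindex gs(1) prod.lessThan_Suc_shift o_def
        case_prod_unfold mult_ac del: prod.lessThan_Suc)
qed

section \<open>Hilbert tensor products\<close>

text \<open>
  All spaces $H^{\otimes k} \otimes V$ are realised inside the single Hilbert space
  \<open>('h list, 'v) ell2\<close>: an orthonormal basis \<open>hbasis\<close> of $H$ is fixed, and an element of
  $H^{\otimes k} \otimes V$ is the family of its ($V$-valued) coordinates, indexed by the
  lists of length $k$ over \<open>hbasis\<close>. The case $V = \mathbb{R}$ gives $H^{\otimes k}$.
  By \<open>inner_tensor_power\<close> and \<open>inner_tensor\<close> below, elementary tensors have the inner products
  that define the Hilbert tensor product, so the closed span of the elementary tensors of
  degree $k$ is (isometrically) $H^{\otimes k} \otimes V$, and different degrees are orthogonal.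
\<close>

definition hbasis :: "'h::{real_inner, second_countable_topology} set" where
  "hbasis = (SOME B. orthonormal_basis B)"

lemma orthonormal_basis_hbasis: "orthonormal_basis hbasis"
  unfolding hbasis_def using orthonormal_basis_exists by (rule someI_ex)

lift_definition tensor_power ::
    "'h::{real_inner, second_countable_topology} list \<Rightarrow> ('h list, real) ell2"
  is "\<lambda>hs es. if set es \<subseteq> hbasis \<and> length es = length hs
              then \<Prod>i<length hs. hs ! i \<bullet> es ! i else 0"
  subgoal for hs
  proof -
    have "(\<lambda>es. (\<Prod>i<length hs. hs ! i \<bullet> es ! i) * (\<Prod>i<length hs. hs ! i \<bullet> es ! i))
        summable_on {es. set es \<subseteq> hbasis \<and> length es = length hs}"
      using orthonormal_basis_parseval_list[OF orthonormal_basis_hbasis refl]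
      by (rule has_sum_imp_summable)
    then show ?thesis
      by (rule iffD1[OF summable_on_cong_neutral, rotated -1]) (auto simp: power2_eq_square)
  qed
  done

lemma inner_tensor_power:
  "tensor_power hs \<bullet> tensor_power gs
    = (if length hs = length gs then \<Prod>i<length hs. hs ! i \<bullet> gs ! i else 0)"
proof (cases "length hs = length gs")
  case False
  then show ?thesis by (simp add: inner_ell2_eq tensor_power.rep_eq infsum_0)
next
  case True
  have "((\<lambda>es. ell2_nth (tensor_power hs) es * ell2_nth (tensor_power gs) es)
      has_sum (\<Prod>i<length hs. hs ! i \<bullet> gs ! i)) UNIV"
    using orthonormal_basis_parseval_list[OF orthonormal_basis_hbasis True[symmetric]]
    by (rule iffD1[OF has_sum_cong_neutral, rotated -1])
      (auto simp: tensor_power.rep_eq True)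
  then show ?thesis by (simp add: inner_ell2_eq True infsumI)
qed

lift_definition tensor :: "('i, real) ell2 \<Rightarrow> 'v::real_inner \<Rightarrow> ('i, 'v) ell2"  (infixl "\<otimes>" 75)
  is "\<lambda>f v i. f i *\<^sub>R v"
  subgoal for f v
    using summable_on_cmult_left[of "\<lambda>i. (norm (f i))\<^sup>2" UNIV "(norm v)\<^sup>2"]
    by (simp add: power_mult_distrib)
  done

lemma inner_tensor: "(S \<otimes> u) \<bullet> (T \<otimes> v) = (S \<bullet> T) * (u \<bullet> v)"
proof -
  have "(S \<otimes> u) \<bullet> (T \<otimes> v) = (\<Sum>\<^sub>\<infinity>i. (ell2_nth S i \<bullet> ell2_nth T i) * (u \<bullet> v))"
    by (simp add: inner_ell2_eq tensor.rep_eq mult_ac)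
  then show ?thesis by (simp only: infsum_cmult_left' inner_ell2_eq)
qed

section \<open>Isonormal Gaussian processes\<close>

text \<open>Possibly degenerate: the constant $0$ counts as Gaussian.\<close>
definition centered_gaussian_rv :: "'w measure \<Rightarrow> ('w \<Rightarrow> real) \<Rightarrow> bool" where
  "centered_gaussian_rv M X \<longleftrightarrow> X \<in> borel_measurable M \<and>
     ((AE \<omega> in M. X \<omega> = 0) \<or> (\<exists>\<sigma>>0. distributed M lborel X (normal_density 0 \<sigma>)))"

definition centered_gaussian_family :: "'w measure \<Rightarrow> ('h \<Rightarrow> 'w \<Rightarrow> real) \<Rightarrow> bool" where
  "centered_gaussian_family M W \<longleftrightarrow>
     (\<forall>(n::nat) (a :: nat \<Rightarrow> real) (h :: nat \<Rightarrow> 'h).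
        centered_gaussian_rv M (\<lambda>\<omega>. \<Sum>i<n. a i * W (h i) \<omega>))"

definition isonormal_process :: "'w measure \<Rightarrow> ('h::real_inner \<Rightarrow> 'w \<Rightarrow> real) \<Rightarrow> bool" where
  "isonormal_process M W \<longleftrightarrow> prob_space M \<and> centered_gaussian_family M W \<and>
     (\<forall>h g. (LINT \<omega>|M. W h \<omega> * W g \<omega>) = h \<bullet> g)"

section \<open>Smooth functions of polynomial growth\<close>

text \<open>
  A function on $\mathbb{R}^m$ is represented by a function on sequences that depends on the
  coordinates below $m$ only. For such functions continuity with respect to the product topology
  of \<open>nat \<Rightarrow> real\<close> is continuity on $\mathbb{R}^m$.
\<close>

definition partial_deriv :: "nat \<Rightarrow> ((nat \<Rightarrow> real) \<Rightarrow> real) \<Rightarrow> (nat \<Rightarrow> real) \<Rightarrow> real" where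
  "partial_deriv i f x = deriv (\<lambda>t. f (x(i := t))) (x i)"

definition partial_derivs :: "nat list \<Rightarrow> ((nat \<Rightarrow> real) \<Rightarrow> real) \<Rightarrow> (nat \<Rightarrow> real) \<Rightarrow> real" where
  "partial_derivs is f = foldr partial_deriv is f"

definition smooth_function :: "nat \<Rightarrow> ((nat \<Rightarrow> real) \<Rightarrow> real) \<Rightarrow> bool" where
  "smooth_function m f \<longleftrightarrow>
     (\<forall>x y. (\<forall>i<m. x i = y i) \<longrightarrow> f x = f y) \<and>
     (\<forall>is \<in> lists {..<m}. continuous_on UNIV (partial_derivs is f) \<and>
        (\<forall>i<m. \<forall>x. (\<lambda>t. partial_derivs is f (x(i := t))) differentiable at (x i)))"

definition polynomial_growth :: "nat \<Rightarrow> ((nat \<Rightarrow> real) \<Rightarrow> real) \<Rightarrow> bool" where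
  "polynomial_growth m f \<longleftrightarrow> (\<exists>C (N::nat). \<forall>x. \<bar>f x\<bar> \<le> C * (1 + L2_set x {..<m}) ^ N)"

section \<open>Malliavin derivatives of smooth random variables\<close>

text \<open>Random variables are identified when they agree almost surely.\<close>

definition cylinder_reps ::
    "'w measure \<Rightarrow> ('h \<Rightarrow> 'w \<Rightarrow> real) \<Rightarrow> ('w \<Rightarrow> real) \<Rightarrow>
     (nat \<times> ((nat \<Rightarrow> real) \<Rightarrow> real) \<times> (nat \<Rightarrow> 'h)) set" where
  "cylinder_reps M W F = {(m, f, h). 1 \<le> m \<and> smooth_function m f \<and>
     (\<forall>is \<in> lists {..<m}. polynomial_growth m (partial_derivs is f)) \<and>
     (AE \<omega> in M. F \<omega> = f (\<lambda>i. W (h i) \<omega>))}"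

definition smooth_rv :: "'w measure \<Rightarrow> ('h \<Rightarrow> 'w \<Rightarrow> real) \<Rightarrow> ('w \<Rightarrow> real) set" where
  "smooth_rv M W = {F \<in> borel_measurable M. cylinder_reps M W F \<noteq> {}}"

text \<open>
  The derivative does not depend, up to null sets, on the representation, so an arbitrary one
  (the same for all orders \<open>k\<close>) is used.
\<close>
definition malliavin_real ::
    "'w measure \<Rightarrow> ('h::{real_inner, second_countable_topology} \<Rightarrow> 'w \<Rightarrow> real) \<Rightarrow> nat \<Rightarrow>
     ('w \<Rightarrow> real) \<Rightarrow> 'w \<Rightarrow> ('h list, real) ell2" where
  "malliavin_real M W k F \<omega> =
     (case (SOME r. r \<in> cylinder_reps M W F) of (m, f, h) \<Rightarrow>
        \<Sum>is \<in> {is. set is \<subseteq> {..<m} \<and> length is = k}.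
          partial_derivs is f (\<lambda>i. W (h i) \<omega>) *\<^sub>R tensor_power (map h is))"

definition smooth_vec_reps ::
    "'w measure \<Rightarrow> ('h \<Rightarrow> 'w \<Rightarrow> real) \<Rightarrow> ('w \<Rightarrow> 'v::real_vector) \<Rightarrow>
     (nat \<times> (nat \<Rightarrow> 'w \<Rightarrow> real) \<times> (nat \<Rightarrow> 'v)) set" where
  "smooth_vec_reps M W F = {(J, G, v). 1 \<le> J \<and> (\<forall>j<J. G j \<in> smooth_rv M W) \<and>
     (AE \<omega> in M. F \<omega> = (\<Sum>j<J. G j \<omega> *\<^sub>R v j))}"

definition smooth_vec_rv ::
    "'w measure \<Rightarrow> ('h \<Rightarrow> 'w \<Rightarrow> real) \<Rightarrow> ('w \<Rightarrow> 'v::real_normed_vector) set" where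
  "smooth_vec_rv M W = {F \<in> borel_measurable M. smooth_vec_reps M W F \<noteq> {}}"

definition malliavin ::
    "'w measure \<Rightarrow> ('h::{real_inner, second_countable_topology} \<Rightarrow> 'w \<Rightarrow> real) \<Rightarrow> nat \<Rightarrow>
     ('w \<Rightarrow> 'v::real_inner) \<Rightarrow> 'w \<Rightarrow> ('h list, 'v) ell2" where
  "malliavin M W k F \<omega> =
     (case (SOME r. r \<in> smooth_vec_reps M W F) of (J, G, v) \<Rightarrow>
        \<Sum>j<J. malliavin_real M W k (G j) \<omega> \<otimes> v j)"

definition L1_norm :: "'w measure \<Rightarrow> ('w \<Rightarrow> 'k::real_normed_vector) \<Rightarrow> real" where
  "L1_norm M G = (LINT \<omega>|M. norm (G \<omega>))"

definition graph_norm ::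
    "'w measure \<Rightarrow> ('h::{real_inner, second_countable_topology} \<Rightarrow> 'w \<Rightarrow> real) \<Rightarrow> nat \<Rightarrow>
     ('w \<Rightarrow> 'v::real_inner) \<Rightarrow> real" where
  "graph_norm M W k F = L1_norm M F + L1_norm M (malliavin M W k F)"

definition sobolev_norm ::
    "'w measure \<Rightarrow> ('h::{real_inner, second_countable_topology} \<Rightarrow> 'w \<Rightarrow> real) \<Rightarrow> nat \<Rightarrow>
     ('w \<Rightarrow> 'v::real_inner) \<Rightarrow> real" where
  "sobolev_norm M W k F = L1_norm M F + (\<Sum>l=1..k. L1_norm M (malliavin M W l F))"

definition eta :: real where
  "eta = pi / 2 + 18 * sqrt (2 * exp 1)"

end

theory Submission
  imports Defs
begin

text \<open>
  Everything follows from one interpolation inequality between consecutive derivatives,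
  $\|D^{l+1}F\|_{L^1} \le \eta\,(\|D^lF\|_{L^1} + \|D^{l+2}F\|_{L^1})$ with $D^0F = F$:
  each derivative that is missing on the right-hand side lies between two that are present, and
  each of those is used at most twice (\<open>interpolated_sums\<close>). The constant obtained is 10, which
  is less than $\eta$.

  The inequality is proved for functionals $G = \sum_p g_p(W(h_{p,0}), W(h_{p,1}), \dots)\,u_p$ with values in
  an arbitrary inner product space, and is applied to $G = D^lF$. It must not depend on the number
  of Gaussian variables, and it rests on two dimension-free facts.

  \<^item> A Poincare inequality (\<open>poincare_inequality\<close>): if $W'$ is an independent copy of $W$, then
    $E\|G(W) - G(W')\| \le \frac{\pi}{2} E\|DG(W)\|$. Rotate $W$ into $W'$ along
    $X_\theta = W\cos\theta + W'\sin\theta$. The velocity of $G(X_\theta)$ is the derivative $DG(X_\theta)$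
    paired with $Y_\theta = X_{\theta + \pi/2}$, and $(X_\theta, Y_\theta)$ has the law of $(W, W')$.
    Given $W$, pairing $DG(W)$ with $W'$ yields a centered Gaussian vector whose second moment is
    $\|DG(W)\|^2$.
  \<^item> The $L^1$ norm of a Gaussian vector controls its $L^2$ norm (\<open>gaussian_vector_lower\<close>).

  Applied to $DG$, the first fact gives a sample point at which the value $A$ of $DG$ satisfies
  $E\|DG - A\| \le \frac{\pi}{2} E\|D^2G\|$. It remains to bound the constant $A$. The
  functional $G - \langle A, W\rangle$ has derivative $DG - A$, so the Poincare inequality
  bounds its oscillation by $\frac{\pi^2}{4} E\|D^2G\|$. The oscillation of the
  Gaussian vector $\langle A, W\rangle$ is therefore at most $2E\|G\| + \frac{\pi^2}{4}E\|D^2G\|$, and by the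
  second fact it is at least $\sqrt{2/\pi}\,\|A\|$ (\<open>first_derivative_bound\<close>).
\<close>

section \<open>Joint characteristic functions determine joint laws\<close>

text \<open>
  A bounded weight \<open>f\<close> becomes a probability density after adding the constant 2, which keeps it
  positive, and normalising. This makes the uniqueness theorem for characteristic functions of
  probability measures available for the signed measure with density \<open>f\<close>.
\<close>
lemma tilted_law:
  fixes f U :: "'a \<Rightarrow> real"
  assumes "prob_space M" and [measurable]: "f \<in> borel_measurable M" "U \<in> borel_measurable M"
    and f1: "\<And>x. \<bar>f x\<bar> \<le> 1"
  defines "c \<equiv> 2 + (LINT x|M. f x)"
  defines "D \<equiv> distr (density M (\<lambda>x. ennreal ((2 + f x) / c))) borel U"
  shows "1 \<le> c" and "real_distribution D"
    and "char D t = (2 * (LINT x|M. iexp (t * U x)) + (LINT x|M. f x *\<^sub>R iexp (t * U x))) / c"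
    and "B \<in> sets borel \<Longrightarrow> c * measure D B
      = 2 * measure (distr M borel U) B + (LINT x|M. f x * indicator B (U x))"
proof -
  interpret prob_space M by fact
  have f2: "0 \<le> 2 + f x" for x using f1[of x] by linarith
  have fint: "integrable M f"
    by (rule integrable_const_bound[of _ 1]) (use f1 in auto)
  have "(LINT x|M. f x) \<ge> (LINT x|M. - 1)"
    by (rule integral_mono[OF _ fint]) (use f1 in \<open>auto simp: abs_le_iff minus_le_iff\<close>)
  then show c1: "1 \<le> c" by (simp add: c_def prob_space)
  have w0: "0 \<le> (2 + f x) / c" for x using f2 c1 by simp
  have emD: "emeasure (density M (\<lambda>x. ennreal ((2 + f x) / c))) (space M) = 1"
  proof -
    have "emeasure (density M (\<lambda>x. ennreal ((2 + f x) / c))) (space M)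
        = (\<integral>\<^sup>+x. ennreal ((2 + f x) / c) \<partial>M)"
      by (subst emeasure_density) (auto intro!: nn_integral_cong)
    also have "\<dots> = ennreal (LINT x|M. (2 + f x) / c)"
      by (rule nn_integral_eq_integral) (use fint w0 in auto)
    also have "(LINT x|M. (2 + f x) / c) = 1"
      using fint c1 by (simp add: c_def prob_space)
    finally show ?thesis by simp
  qed
  interpret D': prob_space "density M (\<lambda>x. ennreal ((2 + f x) / c))"
    by (rule prob_spaceI) (simp add: emD)
  show rD: "real_distribution D"
    unfolding D_def by (rule D'.real_distribution_distr) simp
  have fi: "integrable M (\<lambda>x. f x *\<^sub>R iexp (t * U x))"
    by (rule integrable_const_bound[of _ 1]) (use f1 in auto)
  have ei: "integrable M (\<lambda>x. iexp (t * U x))"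
    by (rule integrable_const_bound[of _ 1]) auto
  have "char D t = (LINT x|M. ((2 + f x) / c) *\<^sub>R iexp (t * U x))"
    unfolding D_def char_def by (subst integral_distr) (simp_all add: integral_density w0)
  also have "\<dots> = (LINT x|M. (2 * iexp (t * U x) + f x *\<^sub>R iexp (t * U x)) / c)"
    by (simp add: scaleR_conv_of_real algebra_simps)
  also have "\<dots> = (2 * (LINT x|M. iexp (t * U x)) + (LINT x|M. f x *\<^sub>R iexp (t * U x))) / c"
    using fi ei by (simp only: integral_divide_zero) simp
  finally show "char D t = (2 * (LINT x|M. iexp (t * U x)) + (LINT x|M. f x *\<^sub>R iexp (t * U x))) / c" .
  show "c * measure D B = 2 * measure (distr M borel U) B + (LINT x|M. f x * indicator B (U x))"
    if [measurable]: "B \<in> sets borel"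
  proof -
    interpret D: real_distribution D by (rule rD)
    have bi: "integrable M (\<lambda>x. indicator B (U x) :: real)"
      by (rule integrable_const_bound[of _ 1]) (auto simp: indicator_def)
    have fbi: "integrable M (\<lambda>x. f x * indicator B (U x))"
      by (rule integrable_const_bound[of _ 1]) (use f1 in \<open>auto simp: indicator_def\<close>)
    have "measure D B = (LINT x|D. indicator B x)"
      by (simp add: D_def)
    also have "\<dots> = (LINT x|M. (2 * indicator B (U x) + f x * indicator B (U x)) / c)"
      unfolding D_def by (subst integral_distr) (simp_all add: integral_density w0 distrib_right)
    also have "\<dots> = (2 * (LINT x|M. indicator B (U x)) + (LINT x|M. f x * indicator B (U x))) / c"
      using bi fbi by (simp only: integral_divide_zero) simp
    also have "(LINT x|M. indicator B (U x)) = (LINT x|distr M borel U. indicator B x :: real)"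
      by (subst integral_distr) simp_all
    also have "\<dots> = measure (distr M borel U) B" by simp
    finally show ?thesis using c1 by simp
  qed
qed

lemma weighted_Levy_uniqueness:
  fixes f U :: "'a \<Rightarrow> real" and g V :: "'b \<Rightarrow> real"
  assumes "prob_space M" "prob_space N"
    and [measurable]: "f \<in> borel_measurable M" "U \<in> borel_measurable M"
      "g \<in> borel_measurable N" "V \<in> borel_measurable N"
    and f1: "\<And>x. \<bar>f x\<bar> \<le> 1" and g1: "\<And>x. \<bar>g x\<bar> \<le> 1"
    and UV: "\<And>t. (LINT x|M. iexp (t * U x)) = (LINT x|N. iexp (t * V x))"
    and fg: "\<And>t. (LINT x|M. f x *\<^sub>R iexp (t * U x)) = (LINT x|N. g x *\<^sub>R iexp (t * V x))"
    and B: "B \<in> sets borel"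
  shows "(LINT x|M. f x * indicator B (U x)) = (LINT x|N. g x * indicator B (V x))"
proof -
  interpret M: prob_space M by fact
  interpret N: prob_space N by fact
  note tM = tilted_law[OF \<open>prob_space M\<close> assms(3,4) f1]
  note tN = tilted_law[OF \<open>prob_space N\<close> assms(5,6) g1]
  have "complex_of_real (LINT x|M. f x) = of_real (LINT x|N. g x)"
    using fg[of 0] by (simp add: scaleR_conv_of_real)
  then have c: "(LINT x|M. f x) = (LINT x|N. g x)" by (simp only: of_real_eq_iff)
  have "distr (density M (\<lambda>x. ennreal ((2 + f x) / (2 + (LINT x|M. f x))))) borel U
      = distr (density N (\<lambda>x. ennreal ((2 + g x) / (2 + (LINT x|N. g x))))) borel V"
    by (intro Levy_uniqueness tM tN ext) (simp only: tM(3) tN(3) UV fg, simp only: c)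
  moreover have "distr M borel U = distr N borel V"
    using UV by (intro Levy_uniqueness M.real_distribution_distr N.real_distribution_distr)
      (auto simp: char_def integral_distr)
  ultimately show ?thesis using tM(4)[OF B] tN(4)[OF B] c by simp
qed

text \<open>
  The exponentials $e^{i a_k X_k}$ are traded for indicators one coordinate at a time: with
  indicators already in place for the coordinates in \<open>J\<close>, the real and imaginary parts of the
  integrand serve as weights in the one-dimensional theorem for the next coordinate. Once all
  coordinates carry an indicator, the probabilities of all boxes agree.
\<close>
lemma Levy_uniqueness_PiM:
  fixes X :: "'i \<Rightarrow> 'a \<Rightarrow> real" and Y :: "'i \<Rightarrow> 'b \<Rightarrow> real"
  assumes "prob_space M" "prob_space N" and I: "finite I"
    and X [measurable]: "\<And>i. i \<in> I \<Longrightarrow> X i \<in> borel_measurable M"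
    and Y [measurable]: "\<And>i. i \<in> I \<Longrightarrow> Y i \<in> borel_measurable N"
    and eq: "\<And>a. (LINT x|M. iexp (\<Sum>i\<in>I. a i * X i x)) = (LINT x|N. iexp (\<Sum>i\<in>I. a i * Y i x))"
  shows "distr M (PiM I (\<lambda>_. borel)) (\<lambda>x. \<lambda>i\<in>I. X i x) = distr N (PiM I (\<lambda>_. borel)) (\<lambda>x. \<lambda>i\<in>I. Y i x)"
proof -
  interpret M: prob_space M by fact
  interpret N: prob_space N by fact
  have key: "(LINT x|M. (\<Prod>i\<in>J. indicator (B i) (X i x)) *\<^sub>R iexp (\<Sum>i\<in>I. a i * X i x))
      = (LINT x|N. (\<Prod>i\<in>J. indicator (B i) (Y i x)) *\<^sub>R iexp (\<Sum>i\<in>I. a i * Y i x))"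
    if "J \<subseteq> I" and B: "\<And>i. B i \<in> sets borel" for J a and B :: "'i \<Rightarrow> real set"
    using finite_subset[OF \<open>J \<subseteq> I\<close> I] that(1)
  proof (induction J arbitrary: a rule: finite_induct)
    case empty then show ?case by (simp only: prod.empty scaleR_one eq)
  next
    case (insert k J)
    then have k [simp]: "k \<in> I" and J: "J \<subseteq> I" by auto
    have [measurable]: "X k \<in> borel_measurable M" "Y k \<in> borel_measurable N" using k X Y by blast+
    note [measurable] = B
    define p where "p x = (\<Prod>i\<in>J. indicator (B i) (X i x) :: real)" for x
    define q where "q x = (\<Prod>i\<in>J. indicator (B i) (Y i x) :: real)" for x
    define S where "S a x = (\<Sum>i\<in>I. a i * X i x)" for a x
    define T where "T a x = (\<Sum>i\<in>I. a i * Y i x)" for a x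
    have [measurable]: "p \<in> borel_measurable M" "q \<in> borel_measurable N"
      "S a \<in> borel_measurable M" "T a \<in> borel_measurable N" for a
      unfolding p_def q_def S_def T_def using J X Y by (auto intro!: borel_measurable_prod borel_measurable_sum
        borel_measurable_times borel_measurable_indicator' simp: subset_iff)
    have p1: "\<bar>p x\<bar> \<le> 1" for x unfolding p_def abs_prod by (rule prod_le_1) (auto simp: indicator_def)
    have q1: "\<bar>q x\<bar> \<le> 1" for x unfolding q_def abs_prod by (rule prod_le_1) (auto simp: indicator_def)
    have IH: "(LINT x|M. p x *\<^sub>R iexp (S b x)) = (LINT x|N. q x *\<^sub>R iexp (T b x))" for b
      using insert.IH[OF J] unfolding p_def q_def S_def T_def .
    have Sa: "S (a(k := a k + t)) x = S a x + t * X k x" "S ((\<lambda>i. - a i)(k := t - a k)) x = t * X k x - S a x"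
      for a t x
      unfolding S_def using I k
      by (simp_all add: sum.remove[OF I k] sum_negf algebra_simps)
    have Ta: "T (a(k := a k + t)) x = T a x + t * Y k x" "T ((\<lambda>i. - a i)(k := t - a k)) x = t * Y k x - T a x"
      for a t x
      unfolding T_def using I k
      by (simp_all add: sum.remove[OF I k] sum_negf algebra_simps)
    have IM: "integrable M (\<lambda>x. p x *\<^sub>R iexp (S b x))" for b
      by (rule M.integrable_const_bound[of _ 1]) (use p1 in auto)
    have IN: "integrable N (\<lambda>x. q x *\<^sub>R iexp (T b x))" for b
      by (rule N.integrable_const_bound[of _ 1]) (use q1 in auto)
    \<comment> \<open>The coefficient family that vanishes except at \<open>k\<close> isolates the variable \<open>X k\<close>.\<close>
    have UV: "(LINT x|M. iexp (t * X k x)) = (LINT x|N. iexp (t * Y k x))" for t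
    proof -
      have "(\<Sum>i\<in>I. ((\<lambda>_. 0)(k := t)) i * X i x) = t * X k x"
        "(\<Sum>i\<in>I. ((\<lambda>_. 0)(k := t)) i * Y i y) = t * Y k y" for x y
        by (simp_all add: sum.remove[OF I k])
      then show ?thesis using eq[of "(\<lambda>_. 0)(k := t)"] by simp
    qed
    \<comment> \<open>Cosine and sine weights split into two exponentials whose exponents are again linear in the variables, with changed coefficients.\<close>
    have cosid: "(r * cos s) *\<^sub>R iexp u = (r *\<^sub>R iexp (s + u) + r *\<^sub>R iexp (u - s)) / 2"
      and sinid: "(r * sin s) *\<^sub>R iexp u = (r *\<^sub>R iexp (s + u) - r *\<^sub>R iexp (u - s)) / (2 * \<i>)"
      for r s u :: real
      by (simp_all add: complex_eq_iff Re_exp Im_exp cos_add cos_diff sin_add sin_diff Re_divide Im_divide algebra_simps)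
    have C: "(LINT x|M. (p x * cos (S a x)) *\<^sub>R iexp (t * X k x))
        = (LINT x|N. (q x * cos (T a x)) *\<^sub>R iexp (t * Y k x))" for t
      unfolding cosid Sa(1)[symmetric] Ta(1)[symmetric] Sa(2)[symmetric] Ta(2)[symmetric] integral_divide_zero
        Bochner_Integration.integral_add[OF IM IM] Bochner_Integration.integral_add[OF IN IN] IH ..
    have D: "(LINT x|M. (p x * sin (S a x)) *\<^sub>R iexp (t * X k x))
        = (LINT x|N. (q x * sin (T a x)) *\<^sub>R iexp (t * Y k x))" for t
      unfolding sinid Sa(1)[symmetric] Ta(1)[symmetric] Sa(2)[symmetric] Ta(2)[symmetric] integral_divide_zero
        Bochner_Integration.integral_diff[OF IM IM] Bochner_Integration.integral_diff[OF IN IN] IH ..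
    have bd: "\<bar>p x * cos u\<bar> \<le> 1" "\<bar>q y * cos u\<bar> \<le> 1" "\<bar>p x * sin u\<bar> \<le> 1" "\<bar>q y * sin u\<bar> \<le> 1" for x y u
      using p1 q1 by (auto simp: abs_mult intro!: mult_le_one)
    have cc: "(LINT x|M. p x * cos (S a x) * indicator (B k) (X k x))
        = (LINT x|N. q x * cos (T a x) * indicator (B k) (Y k x))"
      by (rule weighted_Levy_uniqueness[OF \<open>prob_space M\<close> \<open>prob_space N\<close> _ _ _ _ _ _ UV C]) (auto intro: bd B)
    have ss: "(LINT x|M. p x * sin (S a x) * indicator (B k) (X k x))
        = (LINT x|N. q x * sin (T a x) * indicator (B k) (Y k x))"
      by (rule weighted_Levy_uniqueness[OF \<open>prob_space M\<close> \<open>prob_space N\<close> _ _ _ _ _ _ UV D]) (auto intro: bd B)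
    have splitM: "(LINT x|M. (p x * indicator (B k) (X k x)) *\<^sub>R iexp (S a x))
        = Complex (LINT x|M. p x * cos (S a x) * indicator (B k) (X k x)) (LINT x|M. p x * sin (S a x) * indicator (B k) (X k x))"
    proof -
      have "integrable M (\<lambda>x. (p x * indicator (B k) (X k x)) *\<^sub>R iexp (S a x))"
        by (rule M.integrable_const_bound[of _ 1]) (use p1 in \<open>auto simp: indicator_def\<close>)
      then show ?thesis
        by (auto simp: complex_eq_iff Re_exp Im_exp mult_ac simp flip: integral_Re integral_Im)
    qed
    have splitN: "(LINT x|N. (q x * indicator (B k) (Y k x)) *\<^sub>R iexp (T a x))
        = Complex (LINT x|N. q x * cos (T a x) * indicator (B k) (Y k x)) (LINT x|N. q x * sin (T a x) * indicator (B k) (Y k x))"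
    proof -
      have "integrable N (\<lambda>x. (q x * indicator (B k) (Y k x)) *\<^sub>R iexp (T a x))"
        by (rule N.integrable_const_bound[of _ 1]) (use q1 in \<open>auto simp: indicator_def\<close>)
      then show ?thesis
        by (auto simp: complex_eq_iff Re_exp Im_exp mult_ac simp flip: integral_Re integral_Im)
    qed
    have "(LINT x|M. (p x * indicator (B k) (X k x)) *\<^sub>R iexp (S a x))
        = (LINT x|N. (q x * indicator (B k) (Y k x)) *\<^sub>R iexp (T a x))"
      by (simp only: splitM splitN cc ss)
    then show ?case
      using insert.hyps by (simp add: p_def q_def S_def T_def mult.commute)
  qed
  let ?P = "distr M (PiM I (\<lambda>_. borel)) (\<lambda>x. \<lambda>i\<in>I. X i x)"
  let ?Q = "distr N (PiM I (\<lambda>_. borel)) (\<lambda>x. \<lambda>i\<in>I. Y i x)"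
  have mX [measurable]: "(\<lambda>x. \<lambda>i\<in>I. X i x) \<in> measurable M (PiM I (\<lambda>_. borel))"
    and mY [measurable]: "(\<lambda>x. \<lambda>i\<in>I. Y i x) \<in> measurable N (PiM I (\<lambda>_. borel))"
    by (auto intro!: measurable_restrict)
  show ?thesis
  proof (rule measure_eqI_PiM_finite[OF I, where A = "\<lambda>_. space (PiM I (\<lambda>_. borel))"])
    fix A :: "'i \<Rightarrow> real set" assume A: "\<And>i. i \<in> I \<Longrightarrow> A i \<in> sets borel"
    define B where "B i = (if i \<in> I then A i else {})" for i
    have B: "B i \<in> sets borel" for i using A by (simp add: B_def)
    have AB: "Pi\<^sub>E I A = Pi\<^sub>E I B" by (rule PiE_cong) (simp add: B_def)
    have [measurable]: "Pi\<^sub>E I B \<in> sets (PiM I (\<lambda>_. borel))" using B I by (intro sets_PiM_I_finite) auto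
    have pi: "(\<Prod>i\<in>I. indicator (B i) (z i)) = (indicator (Pi\<^sub>E I B) (\<lambda>i\<in>I. z i) :: real)" for z
      using I by (auto simp: indicator_def prod_eq_1_iff PiE_iff)
    interpret P: prob_space ?P by (rule M.prob_space_distr) simp
    interpret Q: prob_space ?Q by (rule N.prob_space_distr) simp
    have "complex_of_real (measure ?P (Pi\<^sub>E I B)) = of_real (measure ?Q (Pi\<^sub>E I B))"
    proof -
      have "complex_of_real (measure ?P (Pi\<^sub>E I B)) = (LINT x|?P. complex_of_real (indicator (Pi\<^sub>E I B) x))"
        by (simp add: integral_complex_of_real)
      also have "\<dots> = (LINT x|M. complex_of_real (indicator (Pi\<^sub>E I B) (\<lambda>i\<in>I. X i x)))"
        by (subst integral_distr) auto
      also have "\<dots> = (LINT x|N. complex_of_real (indicator (Pi\<^sub>E I B) (\<lambda>i\<in>I. Y i x)))"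
        using key[of I B "\<lambda>_. 0"] B by (simp add: pi scaleR_conv_of_real)
      also have "\<dots> = (LINT x|?Q. complex_of_real (indicator (Pi\<^sub>E I B) x))"
        by (subst integral_distr) auto
      also have "\<dots> = of_real (measure ?Q (Pi\<^sub>E I B))"
        by (simp add: integral_complex_of_real)
      finally show ?thesis .
    qed
    then show "emeasure ?P (Pi\<^sub>E I A) = emeasure ?Q (Pi\<^sub>E I A)"
      by (simp add: AB P.emeasure_eq_measure Q.emeasure_eq_measure)
  next
    show "range (\<lambda>_::nat. space (PiM I (\<lambda>_. borel))) \<subseteq> prod_algebra I (\<lambda>_. borel :: real measure)"
      unfolding space_PiM using I by (auto intro!: prod_algebraI_finite)
    interpret P: prob_space ?P by (rule M.prob_space_distr) simp
    show "emeasure ?P (space (PiM I (\<lambda>_. borel))) \<noteq> \<infinity>"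
      using P.emeasure_finite by simp
  qed auto
qed

section \<open>Gaussian variables and rotations of two independent copies\<close>

lemma (in prob_space) standard_normal_facts:
  assumes D: "distributed M lborel X std_normal_density"
  shows "integrable M (\<lambda>\<omega>. \<bar>X \<omega>\<bar> ^ n)" "(LINT \<omega>|M. X \<omega>) = 0" "(LINT \<omega>|M. (X \<omega>)\<^sup>2) = 1"
    "(LINT \<omega>|M. \<bar>X \<omega>\<bar>) = sqrt (2 / pi)"
    "(LINT \<omega>|M. iexp (t * X \<omega>)) = exp (- (t\<^sup>2) / 2)"
proof -
  show "integrable M (\<lambda>\<omega>. \<bar>X \<omega>\<bar> ^ n)"
    using distributed_integrable[OF D, of "\<lambda>x. \<bar>x\<bar> ^ n"] integrable_std_normal_moment_abs[of n] by simp
  show "(LINT \<omega>|M. X \<omega>) = 0"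
    using distributed_integral[OF D, of "\<lambda>x. x"] integral_std_normal_moment_odd[of 0] by simp
  show "(LINT \<omega>|M. (X \<omega>)\<^sup>2) = 1"
    using distributed_integral[OF D, of "\<lambda>x. x\<^sup>2"] integral_std_normal_moment_even[of 1] by simp
  show "(LINT \<omega>|M. \<bar>X \<omega>\<bar>) = sqrt (2 / pi)"
    using distributed_integral[OF D, of "\<lambda>x. \<bar>x\<bar>"] integral_std_normal_moment_abs_odd[of 0] by simp
  have X: "X \<in> borel_measurable M" using distributed_measurable[OF D] by simp
  have d: "distr M borel X = std_normal_distribution"
    using distributed_distr_eq_density[OF D] by (simp cong: distr_cong)
  have "(LINT \<omega>|M. iexp (t * X \<omega>)) = char (distr M borel X) t"
    unfolding char_def using X by (subst integral_distr) auto
  also have "\<dots> = exp (- (t\<^sup>2) / 2)"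
    by (simp add: d char_std_normal_distribution)
  finally show "(LINT \<omega>|M. iexp (t * X \<omega>)) = exp (- (t\<^sup>2) / 2)" .
qed

text \<open>
  Both kinds of centered Gaussian variable, the null one and the scaled standard normal one, are
  covered by formulas in terms of the variance, so that no later argument distinguishes them.
\<close>
lemma (in prob_space) centered_gaussian_facts:
  assumes "centered_gaussian_rv M X"
  shows "integrable M (\<lambda>\<omega>. \<bar>X \<omega>\<bar> ^ n)"
    and "(LINT \<omega>|M. X \<omega>) = 0"
    and "(LINT \<omega>|M. \<bar>X \<omega>\<bar>) = sqrt (2 / pi) * sqrt (LINT \<omega>|M. (X \<omega>)\<^sup>2)"
    and "(LINT \<omega>|M. iexp (X \<omega>)) = exp (- (LINT \<omega>|M. (X \<omega>)\<^sup>2) / 2)"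
proof -
  have [measurable]: "X \<in> borel_measurable M" using assms by (simp add: centered_gaussian_rv_def)
  have "integrable M (\<lambda>\<omega>. \<bar>X \<omega>\<bar> ^ n) \<and> (LINT \<omega>|M. X \<omega>) = 0
    \<and> (LINT \<omega>|M. \<bar>X \<omega>\<bar>) = sqrt (2 / pi) * sqrt (LINT \<omega>|M. (X \<omega>)\<^sup>2)
    \<and> (LINT \<omega>|M. iexp (X \<omega>)) = exp (- (LINT \<omega>|M. (X \<omega>)\<^sup>2) / 2)"
  proof (cases "AE \<omega> in M. X \<omega> = 0")
    case True
    have "integrable M (\<lambda>\<omega>. \<bar>X \<omega>\<bar> ^ n) \<longleftrightarrow> integrable M (\<lambda>\<omega>. \<bar>0::real\<bar> ^ n)"
      by (rule integrable_cong_AE) (use True in auto)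
    moreover have "(LINT \<omega>|M. X \<omega>) = (LINT \<omega>|M. 0)" "(LINT \<omega>|M. \<bar>X \<omega>\<bar>) = (LINT \<omega>|M. 0)"
      "(LINT \<omega>|M. (X \<omega>)\<^sup>2) = (LINT \<omega>|M. 0)" "(LINT \<omega>|M. iexp (X \<omega>)) = (LINT \<omega>|M. 1)"
      by (rule integral_cong_AE; use True in auto)+
    ultimately show ?thesis by (simp add: prob_space)
  next
    case False
    then obtain s where s: "s > 0" "distributed M lborel X (normal_density 0 s)"
      using assms by (auto simp: centered_gaussian_rv_def)
    define Z where "Z \<omega> = X \<omega> / s" for \<omega>
    have Z: "distributed M lborel Z std_normal_density"
      using s normal_standard_normal_convert[of s X 0] by (simp add: Z_def[abs_def])
    have XZ: "X = (\<lambda>\<omega>. s * Z \<omega>)" using s by (auto simp: Z_def)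
    note f = standard_normal_facts[OF Z]
    show ?thesis unfolding XZ
      using s f(1)[of n] f(5)[of s] by (simp add: abs_mult power_mult_distrib f real_sqrt_mult)
  qed
  then show "integrable M (\<lambda>\<omega>. \<bar>X \<omega>\<bar> ^ n)" "(LINT \<omega>|M. X \<omega>) = 0"
    "(LINT \<omega>|M. \<bar>X \<omega>\<bar>) = sqrt (2 / pi) * sqrt (LINT \<omega>|M. (X \<omega>)\<^sup>2)"
    "(LINT \<omega>|M. iexp (X \<omega>)) = exp (- (LINT \<omega>|M. (X \<omega>)\<^sup>2) / 2)" by auto
qed

locale isonormal =
  fixes M :: "'w measure" and W :: "'h::{real_inner, second_countable_topology} \<Rightarrow> 'w \<Rightarrow> real"
  assumes isonormal: "isonormal_process M W"
begin

sublocale prob_space M using isonormal by (simp add: isonormal_process_def)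

lemma gaussian_sum:
  assumes "finite Q"
  shows "centered_gaussian_rv M (\<lambda>\<omega>. \<Sum>q\<in>Q. a q * W (k q) \<omega>)"
proof -
  obtain b where b: "bij_betw b {..<card Q} Q"
    using ex_bij_betw_nat_finite[OF assms] by (auto simp: atLeast0LessThan)
  have "(\<lambda>\<omega>. \<Sum>q\<in>Q. a q * W (k q) \<omega>) = (\<lambda>\<omega>. \<Sum>i<card Q. (a \<circ> b) i * W ((k \<circ> b) i) \<omega>)"
    by (rule ext) (simp add: sum.reindex_bij_betw[OF b, symmetric])
  then show ?thesis using isonormal by (simp add: isonormal_process_def centered_gaussian_family_def)
qed

lemma gaussian_W: "centered_gaussian_rv M (W h)"
  using gaussian_sum[of "{()}" "\<lambda>_. 1" "\<lambda>_. h"] by simp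

lemma W_measurable [measurable]: "W h \<in> borel_measurable M"
  using gaussian_W by (simp add: centered_gaussian_rv_def)

lemma integrable_W_mult: "integrable M (\<lambda>\<omega>. W h \<omega> * W g \<omega>)"
proof (rule Bochner_Integration.integrable_bound)
  show "integrable M (\<lambda>\<omega>. \<bar>W h \<omega>\<bar> ^ 2 + \<bar>W g \<omega>\<bar> ^ 2)"
    by (intro Bochner_Integration.integrable_add centered_gaussian_facts gaussian_W)
  have "norm (x * y) \<le> norm (\<bar>x\<bar> ^ 2 + \<bar>y\<bar> ^ 2)" for x y :: real
    using sum_squares_bound[of "\<bar>x\<bar>" "\<bar>y\<bar>"] mult_nonneg_nonneg[OF abs_ge_zero[of x] abs_ge_zero[of y]]
    unfolding real_norm_def abs_mult by linarith
  then show "AE \<omega> in M. norm (W h \<omega> * W g \<omega>) \<le> norm (\<bar>W h \<omega>\<bar> ^ 2 + \<bar>W g \<omega>\<bar> ^ 2)" by simp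
qed measurable

lemma integral_W_mult: "(LINT \<omega>|M. W h \<omega> * W g \<omega>) = h \<bullet> g"
  using isonormal by (simp add: isonormal_process_def)

lemma second_moment_sum:
  assumes "finite Q"
  shows "(LINT \<omega>|M. (\<Sum>q\<in>Q. a q * W (k q) \<omega>)\<^sup>2) = (norm (\<Sum>q\<in>Q. a q *\<^sub>R k q))\<^sup>2"
proof -
  have "(\<Sum>q\<in>Q. a q * W (k q) \<omega>)\<^sup>2 = (\<Sum>q\<in>Q. \<Sum>r\<in>Q. (a q * a r) * (W (k q) \<omega> * W (k r) \<omega>))" for \<omega>
    by (simp add: power2_eq_square sum_product mult_ac)
  then have "(LINT \<omega>|M. (\<Sum>q\<in>Q. a q * W (k q) \<omega>)\<^sup>2) = (\<Sum>q\<in>Q. \<Sum>r\<in>Q. (a q * a r) * (k q \<bullet> k r))"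
    by (simp add: integral_W_mult integrable_W_mult)
  also have "\<dots> = (norm (\<Sum>q\<in>Q. a q *\<^sub>R k q))\<^sup>2"
    by (simp add: power2_norm_eq_inner inner_sum_left inner_sum_right sum_distrib_left mult_ac inner_commute)
  finally show ?thesis .
qed

lemma characteristic_function:
  assumes "finite Q"
  shows "(LINT \<omega>|M. iexp (\<Sum>q\<in>Q. a q * W (k q) \<omega>)) = exp (- (norm (\<Sum>q\<in>Q. a q *\<^sub>R k q))\<^sup>2 / 2)"
  using centered_gaussian_facts(4)[OF gaussian_sum[OF assms]] by (simp only: second_moment_sum[OF assms])

sublocale two: pair_prob_space M M ..

text \<open>
  On the product space the two coordinates carry independent copies of $W$; the velocity of the
  rotation at angle $\theta$ is the rotation at angle $\theta + \pi/2$.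
\<close>
definition rot :: "real \<Rightarrow> 'w \<times> 'w \<Rightarrow> 'h \<Rightarrow> real" where
  "rot \<theta> x h = cos \<theta> * W h (fst x) + sin \<theta> * W h (snd x)"

lemma rot_measurable [measurable]: "(\<lambda>x. rot \<theta> x h) \<in> borel_measurable (M \<Otimes>\<^sub>M M)"
  unfolding rot_def by measurable

text \<open>
  Collecting the coefficients of the two copies rotates the pair of vectors with coefficients
  \<open>a\<close> and \<open>b\<close> by an orthogonal matrix, which preserves the sum of their squared norms. The value is
  thus the same for every $\theta$.
\<close>
lemma rot_characteristic_function:
  assumes S: "finite S"
  shows "(LINT x|(M \<Otimes>\<^sub>M M). iexp (\<Sum>h\<in>S. a h * rot \<theta> x h + b h * rot (\<theta> + pi / 2) x h))
    = exp (- ((norm (\<Sum>h\<in>S. a h *\<^sub>R h))\<^sup>2 + (norm (\<Sum>h\<in>S. b h *\<^sub>R h))\<^sup>2) / 2)"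
proof -
  define A where "A \<omega> = (\<Sum>h\<in>S. (a h * cos \<theta> - b h * sin \<theta>) * W h \<omega>)" for \<omega>
  define B where "B \<omega> = (\<Sum>h\<in>S. (a h * sin \<theta> + b h * cos \<theta>) * W h \<omega>)" for \<omega>
  have [measurable]: "A \<in> borel_measurable M" "B \<in> borel_measurable M"
    unfolding A_def B_def by measurable
  have AB: "(\<Sum>h\<in>S. a h * rot \<theta> x h + b h * rot (\<theta> + pi / 2) x h) = A (fst x) + B (snd x)" for x
    by (simp add: A_def B_def rot_def cos_add sin_add algebra_simps flip: sum.distrib)
  have int: "integrable (M \<Otimes>\<^sub>M M) (\<lambda>(x, y). iexp (A x) * iexp (B y))"
    by (rule two.integrable_const_bound[of _ 1]) (auto simp: norm_mult)
  have "(LINT x|(M \<Otimes>\<^sub>M M). iexp (\<Sum>h\<in>S. a h * rot \<theta> x h + b h * rot (\<theta> + pi / 2) x h))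
      = (LINT x|(M \<Otimes>\<^sub>M M). (case x of (x, y) \<Rightarrow> iexp (A x) * iexp (B y)))"
    by (simp add: AB exp_add distrib_left case_prod_unfold)
  also have "\<dots> = (LINT x|M. LINT y|M. iexp (A x) * iexp (B y))"
    by (rule two.integral_fst[symmetric]) (rule int)
  also have "\<dots> = (LINT x|M. iexp (A x)) * (LINT y|M. iexp (B y))" by simp
  also have "(LINT x|M. iexp (A x)) = exp (- (norm (\<Sum>h\<in>S. (a h * cos \<theta> - b h * sin \<theta>) *\<^sub>R h))\<^sup>2 / 2)"
    unfolding A_def using characteristic_function[OF S, of _ "\<lambda>h. h"] .
  also have "(LINT x|M. iexp (B x)) = exp (- (norm (\<Sum>h\<in>S. (a h * sin \<theta> + b h * cos \<theta>) *\<^sub>R h))\<^sup>2 / 2)"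
    unfolding B_def using characteristic_function[OF S, of _ "\<lambda>h. h"] .
  also have "complex_of_real (exp (- (norm (\<Sum>h\<in>S. (a h * cos \<theta> - b h * sin \<theta>) *\<^sub>R h))\<^sup>2 / 2))
      * exp (- (norm (\<Sum>h\<in>S. (a h * sin \<theta> + b h * cos \<theta>) *\<^sub>R h))\<^sup>2 / 2)
    = exp (- ((norm (\<Sum>h\<in>S. (a h * cos \<theta> - b h * sin \<theta>) *\<^sub>R h))\<^sup>2
        + (norm (\<Sum>h\<in>S. (a h * sin \<theta> + b h * cos \<theta>) *\<^sub>R h))\<^sup>2) / 2)"
    by (simp add: add_divide_distrib diff_divide_distrib flip: of_real_mult exp_add)
  also have "(norm (\<Sum>h\<in>S. (a h * cos \<theta> - b h * sin \<theta>) *\<^sub>R h))\<^sup>2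
        + (norm (\<Sum>h\<in>S. (a h * sin \<theta> + b h * cos \<theta>) *\<^sub>R h))\<^sup>2
      = (norm (\<Sum>h\<in>S. a h *\<^sub>R h))\<^sup>2 + (norm (\<Sum>h\<in>S. b h *\<^sub>R h))\<^sup>2"
  proof -
    have pyth: "(norm (c *\<^sub>R u - s *\<^sub>R v))\<^sup>2 + (norm (s *\<^sub>R u + c *\<^sub>R v))\<^sup>2 = (norm u)\<^sup>2 + (norm v)\<^sup>2"
      if "c\<^sup>2 + s\<^sup>2 = 1" for c s and u v :: 'h
    proof -
      have "(norm (c *\<^sub>R u - s *\<^sub>R v))\<^sup>2 + (norm (s *\<^sub>R u + c *\<^sub>R v))\<^sup>2 = (c\<^sup>2 + s\<^sup>2) * ((norm u)\<^sup>2 + (norm v)\<^sup>2)"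
        by (simp add: power2_norm_eq_inner inner_simps inner_commute[of v u])
          (simp add: power2_eq_square algebra_simps)
      then show ?thesis using that by simp
    qed
    have e: "(\<Sum>h\<in>S. (a h * cos \<theta> - b h * sin \<theta>) *\<^sub>R h) = cos \<theta> *\<^sub>R (\<Sum>h\<in>S. a h *\<^sub>R h) - sin \<theta> *\<^sub>R (\<Sum>h\<in>S. b h *\<^sub>R h)"
      "(\<Sum>h\<in>S. (a h * sin \<theta> + b h * cos \<theta>) *\<^sub>R h) = sin \<theta> *\<^sub>R (\<Sum>h\<in>S. a h *\<^sub>R h) + cos \<theta> *\<^sub>R (\<Sum>h\<in>S. b h *\<^sub>R h)"
      by (simp_all add: scaleR_left_diff_distrib scaleR_left_distrib scaleR_sum_right sum_subtractf sum.distrib mult.commute)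
    show ?thesis unfolding e by (rule pyth) simp
  qed
  finally show ?thesis .
qed

text \<open>
  The flag in the index distinguishes the position (\<open>False\<close>) from the velocity (\<open>True\<close>), so
  that the invariance concerns their joint law.
\<close>
lemma rotation_invariance:
  fixes \<Phi> :: "('h \<times> bool \<Rightarrow> real) \<Rightarrow> ennreal"
  assumes S: "finite S" and [measurable]: "\<Phi> \<in> borel_measurable (PiM (S \<times> UNIV) (\<lambda>_. borel))"
  shows "(\<integral>\<^sup>+x. \<Phi> (\<lambda>(h, b)\<in>S \<times> UNIV. rot (if b then \<theta> + pi / 2 else \<theta>) x h) \<partial>(M \<Otimes>\<^sub>M M))
    = (\<integral>\<^sup>+x. \<Phi> (\<lambda>(h, b)\<in>S \<times> UNIV. W h (if b then snd x else fst x)) \<partial>(M \<Otimes>\<^sub>M M))"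
proof -
  let ?I = "S \<times> (UNIV :: bool set)"
  let ?N = "PiM ?I (\<lambda>_. borel :: real measure)"
  define Z where "Z \<theta> = (\<lambda>(h, b) x. rot (if b then \<theta> + pi / 2 else \<theta>) x h)" for \<theta>
  have Z [measurable]: "Z \<theta> i \<in> borel_measurable (M \<Otimes>\<^sub>M M)" for \<theta> i
    by (cases i) (simp add: Z_def)
  have [measurable]: "(\<lambda>x. \<lambda>i\<in>?I. Z \<theta> i x) \<in> measurable (M \<Otimes>\<^sub>M M) ?N" for \<theta>
    by (rule measurable_restrict) simp
  have Zchar: "(LINT x|(M \<Otimes>\<^sub>M M). iexp (\<Sum>i\<in>?I. a i * Z \<theta> i x))
      = exp (- ((norm (\<Sum>h\<in>S. a (h, False) *\<^sub>R h))\<^sup>2 + (norm (\<Sum>h\<in>S. a (h, True) *\<^sub>R h))\<^sup>2) / 2)" for a \<theta>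
  proof -
    have "(\<Sum>i\<in>?I. a i * Z \<theta> i x) = (\<Sum>h\<in>S. a (h, False) * rot \<theta> x h + a (h, True) * rot (\<theta> + pi / 2) x h)" for x
    proof -
      have "(\<Sum>i\<in>?I. a i * Z \<theta> i x) = (\<Sum>h\<in>S. \<Sum>b\<in>UNIV. a (h, b) * Z \<theta> (h, b) x)"
        by (simp only: sum.cartesian_product) (simp add: case_prod_unfold)
      then show ?thesis by (simp add: Z_def UNIV_bool add.commute)
    qed
    then show ?thesis by (simp only: rot_characteristic_function[OF S])
  qed
  have law: "distr (M \<Otimes>\<^sub>M M) ?N (\<lambda>x. \<lambda>i\<in>?I. Z \<theta> i x) = distr (M \<Otimes>\<^sub>M M) ?N (\<lambda>x. \<lambda>i\<in>?I. Z 0 i x)"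
    by (rule Levy_uniqueness_PiM[OF two.prob_space_axioms two.prob_space_axioms])
      (use S in \<open>simp_all only: Zchar finite_cartesian_product finite Z\<close>)
  have "(\<integral>\<^sup>+x. \<Phi> (\<lambda>i\<in>?I. Z \<theta> i x) \<partial>(M \<Otimes>\<^sub>M M)) = (\<integral>\<^sup>+x. \<Phi> (\<lambda>i\<in>?I. Z 0 i x) \<partial>(M \<Otimes>\<^sub>M M))"
    using arg_cong[OF law, of "\<lambda>D. nn_integral D \<Phi>"] by (simp add: nn_integral_distr)
  moreover have "(\<lambda>i\<in>?I. Z \<theta> i x) = (\<lambda>(h, b)\<in>?I. rot (if b then \<theta> + pi / 2 else \<theta>) x h)" for x
    by (auto simp: Z_def restrict_def fun_eq_iff)
  moreover have "(\<lambda>i\<in>?I. Z 0 i x) = (\<lambda>(h, b)\<in>?I. W h (if b then snd x else fst x))" for x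
    by (auto simp: Z_def restrict_def fun_eq_iff rot_def)
  ultimately show ?thesis by simp
qed

end

section \<open>Functions with continuous partial derivatives of polynomial growth\<close>

text \<open>
  The Poincare inequality uses one derivative only. Stating it for this class makes it
  available for \<open>g\<close> minus a linear function, without computing higher derivatives of the difference.
\<close>
definition C1_growth :: "nat \<Rightarrow> ((nat \<Rightarrow> real) \<Rightarrow> real) \<Rightarrow> bool" where
  "C1_growth m g \<longleftrightarrow>
     (\<forall>x y. (\<forall>i<m. x i = y i) \<longrightarrow> g x = g y) \<and> continuous_on UNIV g \<and> polynomial_growth m g \<and>
     (\<forall>i<m. (\<forall>x. (\<lambda>t. g (x(i := t))) differentiable at (x i)) \<and>
        continuous_on UNIV (partial_deriv i g) \<and> polynomial_growth m (partial_deriv i g))"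

definition smooth_growth :: "nat \<Rightarrow> ((nat \<Rightarrow> real) \<Rightarrow> real) \<Rightarrow> bool" where
  "smooth_growth m g \<longleftrightarrow> smooth_function m g \<and>
     (\<forall>is \<in> lists {..<m}. polynomial_growth m (partial_derivs is g))"

lemma C1_growth_cong: "C1_growth m g \<Longrightarrow> (\<And>i. i < m \<Longrightarrow> x i = y i) \<Longrightarrow> g x = g y"
  by (auto simp: C1_growth_def)

lemma partial_deriv_cong:
  assumes "\<And>x y. (\<And>i. i < m \<Longrightarrow> x i = y i) \<Longrightarrow> g x = g y"
    and "i < m" "\<And>i. i < m \<Longrightarrow> x i = y i"
  shows "partial_deriv i g x = partial_deriv i g y"
proof -
  have "(\<lambda>t. g (x(i := t))) = (\<lambda>t. g (y(i := t)))"
    by (rule ext, rule assms(1)) (use assms(3) in auto)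
  then show ?thesis using assms(2,3) by (simp add: partial_deriv_def)
qed

lemma C1_growth_partial_deriv_cong:
  "C1_growth m g \<Longrightarrow> i < m \<Longrightarrow> (\<And>i. i < m \<Longrightarrow> x i = y i) \<Longrightarrow> partial_deriv i g x = partial_deriv i g y"
  by (rule partial_deriv_cong) (auto intro: C1_growth_cong)

lemma partial_derivs_snoc: "partial_derivs (is @ [i]) g = partial_derivs is (partial_deriv i g)"
  by (simp add: partial_derivs_def)

lemma partial_derivs_Cons: "partial_derivs (i # is) g = partial_deriv i (partial_derivs is g)"
  by (simp add: partial_derivs_def)

lemma smooth_growth_partial_deriv:
  assumes g: "smooth_growth m g" and i: "i < m"
  shows "smooth_growth m (partial_deriv i g)"
proof -
  have snoc: "is @ [i] \<in> lists {..<m}" if "is \<in> lists {..<m}" for "is"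
    using that i by auto
  show ?thesis unfolding smooth_growth_def smooth_function_def
  proof (intro conjI allI impI ballI)
    fix x y :: "nat \<Rightarrow> real" assume "\<forall>i<m. x i = y i"
    then show "partial_deriv i g x = partial_deriv i g y"
      using g i by (intro partial_deriv_cong[of m g]) (auto simp: smooth_growth_def smooth_function_def)
  qed (use g snoc in \<open>auto simp: smooth_growth_def smooth_function_def simp flip: partial_derivs_snoc\<close>)
qed

lemma smooth_growth_partial_derivs:
  assumes "smooth_growth m g" and "set is \<subseteq> {..<m}"
  shows "smooth_growth m (partial_derivs is g)"
  using assms(2)
proof (induction "is")
  case Nil then show ?case using assms(1) by (simp add: partial_derivs_def)
next
  case (Cons i "is") then show ?case by (simp add: partial_derivs_Cons smooth_growth_partial_deriv)
qed

lemma smooth_growth_C1_growth: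
  assumes g: "smooth_growth m g"
  shows "C1_growth m g"
proof -
  have A: "continuous_on UNIV h \<and> polynomial_growth m h \<and> (\<forall>i<m. \<forall>x. (\<lambda>t. h (x(i := t))) differentiable at (x i))"
    if "smooth_growth m h" for h
  proof -
    have "[] \<in> lists {..<m}" by simp
    with that have "continuous_on UNIV (partial_derivs [] h) \<and> polynomial_growth m (partial_derivs [] h)
        \<and> (\<forall>i<m. \<forall>x. (\<lambda>t. partial_derivs [] h (x(i := t))) differentiable at (x i))"
      unfolding smooth_growth_def smooth_function_def by blast
    then show ?thesis by (simp add: partial_derivs_def)
  qed
  have "\<forall>x y. (\<forall>i<m. x i = y i) \<longrightarrow> g x = g y" using g by (auto simp: smooth_growth_def smooth_function_def)
  then show ?thesis
    unfolding C1_growth_def using A[OF g] A[OF smooth_growth_partial_deriv[OF g]] by blast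
qed

lemma C1_growth_has_partial_deriv:
  assumes "C1_growth m g" "i < m"
  shows "((\<lambda>t. g (x(i := t))) has_real_derivative partial_deriv i g (x(i := s))) (at s)"
proof -
  have "(\<lambda>t. g ((x(i := s))(i := t))) differentiable at ((x(i := s)) i)"
    using assms unfolding C1_growth_def by blast
  then have "(\<lambda>t. g (x(i := t))) differentiable at s" by simp
  then obtain D where "((\<lambda>t. g (x(i := t))) has_real_derivative D) (at s)"
    using real_differentiable_def by blast
  then show ?thesis by (simp add: partial_deriv_def DERIV_imp_deriv)
qed

lemma polynomial_growth_add_linear:
  assumes "polynomial_growth m g" and "\<And>x. \<bar>d x\<bar> \<le> c * (1 + L2_set x {..<m})"
  shows "polynomial_growth m (\<lambda>x. g x + d x)"
proof -
  obtain C N where C: "\<And>x. \<bar>g x\<bar> \<le> C * (1 + L2_set x {..<m}) ^ N"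
    using assms(1) by (auto simp: polynomial_growth_def)
  have "\<bar>g x + d x\<bar> \<le> (\<bar>C\<bar> + \<bar>c\<bar>) * (1 + L2_set x {..<m}) ^ (N + 1)" for x
  proof -
    let ?r = "1 + L2_set x {..<m}"
    have r: "1 \<le> ?r" by simp
    have "\<bar>g x\<bar> \<le> \<bar>C\<bar> * ?r ^ (N + 1)"
      by (rule order_trans[OF C mult_mono]) (use r power_increasing[of N "N + 1" ?r] in auto)
    moreover have "\<bar>d x\<bar> \<le> \<bar>c\<bar> * ?r ^ (N + 1)"
      by (rule order_trans[OF assms(2) mult_mono]) (use r self_le_power[of ?r "N + 1"] in auto)
    ultimately show ?thesis by (simp add: distrib_right)
  qed
  then show ?thesis unfolding polynomial_growth_def by blast
qed

lemma
  assumes g: "C1_growth m g"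
  shows C1_growth_diff_linear: "C1_growth m (\<lambda>x. g x - (\<Sum>i<m. c i * x i))"
    and partial_deriv_diff_linear:
      "i < m \<Longrightarrow> partial_deriv i (\<lambda>x. g x - (\<Sum>i<m. c i * x i)) = (\<lambda>x. partial_deriv i g x - c i)"
proof -
  let ?f = "\<lambda>x. g x - (\<Sum>i<m. c i * x i)"
  have der: "((\<lambda>t. ?f (x(i := t))) has_real_derivative partial_deriv i g (x(i := s)) - c i) (at s)"
    if i: "i < m" for i x s
  proof -
    have e: "(\<Sum>j<m. c j * (x(i := t)) j) = (\<Sum>j\<in>{..<m} - {i}. c j * x j) + c i * t" for t
      using i by (subst sum.remove[of _ i]) auto
    show ?thesis unfolding e
      by (rule derivative_eq_intros C1_growth_has_partial_deriv[OF g i] refl)+ simp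
  qed
  show pd: "partial_deriv i ?f = (\<lambda>x. partial_deriv i g x - c i)" if "i < m" for i
  proof
    fix x show "partial_deriv i ?f x = partial_deriv i g x - c i"
      using DERIV_imp_deriv[OF der[OF that, of x "x i"]] by (simp add: partial_deriv_def)
  qed
  have abs_le: "\<bar>x i\<bar> \<le> L2_set x {..<m}" if "i < m" for x i
    using member_le_L2_set[of "{..<m}" i "\<lambda>i. \<bar>x i\<bar>"] that by (simp add: L2_set_def)
  have "\<bar>- (\<Sum>i<m. c i * x i)\<bar> \<le> (\<Sum>i<m. \<bar>c i\<bar>) * (1 + L2_set x {..<m})" for x
  proof -
    have "\<bar>- (\<Sum>i<m. c i * x i)\<bar> \<le> (\<Sum>i<m. \<bar>c i\<bar> * \<bar>x i\<bar>)"
      using sum_abs[of "\<lambda>i. c i * x i" "{..<m}"] by (simp add: abs_mult)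
    also have "\<dots> \<le> (\<Sum>i<m. \<bar>c i\<bar> * (1 + L2_set x {..<m}))"
      by (intro sum_mono mult_left_mono) (auto intro: order_trans[OF abs_le])
    finally show ?thesis by (simp add: sum_distrib_right)
  qed
  with g have pg: "polynomial_growth m ?f"
    using polynomial_growth_add_linear[of m g "\<lambda>x. - (\<Sum>i<m. c i * x i)"] by (auto simp: C1_growth_def)
  have pg': "polynomial_growth m (\<lambda>x. partial_deriv i g x - c i)" if "i < m" for i
    using polynomial_growth_add_linear[of m "partial_deriv i g" "\<lambda>x. - c i" "\<bar>c i\<bar>"] g that
    by (auto simp: C1_growth_def mult_le_cancel_left1)
  show "C1_growth m ?f"
    unfolding C1_growth_def
  proof (intro conjI allI impI)
    show "?f x = ?f y" if "\<forall>i<m. x i = y i" for x y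
      using that C1_growth_cong[OF g, of x y] by simp
    show "continuous_on UNIV ?f"
      using g by (intro continuous_intros) (auto simp: C1_growth_def intro: continuous_on_product_then_coordinatewise)
    show "(\<lambda>t. ?f (x(i := t))) differentiable at (x i)" if "i < m" for x i
      using der[OF that] real_differentiable_def by blast
    show "continuous_on UNIV (partial_deriv i ?f)" if "i < m" for i
      unfolding pd[OF that] using g that by (intro continuous_intros) (auto simp: C1_growth_def)
    show "polynomial_growth m (partial_deriv i ?f)" if "i < m" for i
      unfolding pd[OF that] by (rule pg'[OF that])
  qed (rule pg)
qed

text \<open>
  The coordinates of the point are moved one after the other, and the mean value theorem is applied to each
  move; continuity of the partial derivatives then gives the limit of each difference quotient.
\<close>
lemma C1_growth_chain_rule:
  assumes g: "C1_growth m g"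
    and x: "\<And>i. ((\<lambda>s. x s i) has_real_derivative x' i) (at t)"
  shows "((\<lambda>s. g (x s)) has_real_derivative (\<Sum>i<m. partial_deriv i g (x t) * x' i)) (at t)"
proof -
  \<comment> \<open>The point in which the first \<open>k\<close> coordinates have been moved from time \<open>t\<close> to time \<open>s\<close>.\<close>
  define y where "y k s i = (if i < k then x s i else x t i)" for k s and i :: nat
  have step: "\<exists>u. min (x t k) (x s k) \<le> u \<and> u \<le> max (x t k) (x s k) \<and>
      g (y (Suc k) s) - g (y k s) = partial_deriv k g ((y k s)(k := u)) * (x s k - x t k)"
    if k: "k < m" for k s
  proof -
    have e: "y (Suc k) s = (y k s)(k := x s k)" "y k s = (y k s)(k := x t k)"
      by (auto simp: y_def fun_eq_iff less_Suc_eq)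
    note der = C1_growth_has_partial_deriv[OF g k, of "y k s"]
    consider "x t k < x s k" | "x s k < x t k" | "x s k = x t k" by linarith
    then show ?thesis
    proof cases
      case 1
      from MVT2[OF 1 der] obtain z where z: "x t k < z" "z < x s k"
        "g ((y k s)(k := x s k)) - g ((y k s)(k := x t k)) = (x s k - x t k) * partial_deriv k g ((y k s)(k := z))"
        by blast
      then show ?thesis using 1 by (intro exI[of _ z]) (simp add: e(1) mult.commute flip: e(2))
    next
      case 2
      from MVT2[OF 2 der] obtain z where z: "x s k < z" "z < x t k"
        "g ((y k s)(k := x t k)) - g ((y k s)(k := x s k)) = (x t k - x s k) * partial_deriv k g ((y k s)(k := z))"
        by blast
      then show ?thesis using 2 by (intro exI[of _ z]) (simp add: e(1) algebra_simps flip: e(2))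
    next
      case 3 then show ?thesis by (intro exI[of _ "x t k"]) (simp add: e(1) flip: e(2))
    qed
  qed
  then have "\<forall>k s. \<exists>u. k < m \<longrightarrow> min (x t k) (x s k) \<le> u \<and> u \<le> max (x t k) (x s k) \<and>
      g (y (Suc k) s) - g (y k s) = partial_deriv k g ((y k s)(k := u)) * (x s k - x t k)"
    by blast
  then obtain u where u: "\<And>k s. k < m \<Longrightarrow> min (x t k) (x s k) \<le> u k s \<and> u k s \<le> max (x t k) (x s k) \<and>
      g (y (Suc k) s) - g (y k s) = partial_deriv k g ((y k s)(k := u k s)) * (x s k - x t k)"
    by metis
  have xc: "((\<lambda>s. x s i) \<longlongrightarrow> x t i) (at t)" for i
    using DERIV_isCont[OF x[of i]] by (simp add: isCont_def)
  have lim: "((\<lambda>s. partial_deriv k g ((y k s)(k := u k s))) \<longlongrightarrow> partial_deriv k g (x t)) (at t)"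
    if k: "k < m" for k
  proof (rule isCont_tendsto_compose[of _ "partial_deriv k g"])
    show "isCont (partial_deriv k g) (x t)"
      using g k by (auto simp: C1_growth_def continuous_on_eq_continuous_at)
    have uk: "((\<lambda>s. u k s) \<longlongrightarrow> x t k) (at t)"
    proof (rule tendsto_sandwich)
      show "((\<lambda>s. min (x t k) (x s k)) \<longlongrightarrow> x t k) (at t)" using tendsto_min[OF tendsto_const[of "x t k"] xc[of k]] by simp
      show "((\<lambda>s. max (x t k) (x s k)) \<longlongrightarrow> x t k) (at t)" using tendsto_max[OF tendsto_const[of "x t k"] xc[of k]] by simp
    qed (use u[OF k] in auto)
    have "((\<lambda>s. ((y k s)(k := u k s)) i) \<longlongrightarrow> x t i) (at t)" for i
      using uk xc[of i] by (cases "i = k"; cases "i < k") (simp_all add: y_def)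
    then show "((\<lambda>s. (y k s)(k := u k s)) \<longlongrightarrow> x t) (at t)"
      using limitin_componentwise[of "\<lambda>_. euclidean" UNIV "\<lambda>s. (y k s)(k := u k s)" "x t" "at t"]
      by (simp add: euclidean_product_topology extensional_def del: fun_upd_apply)
  qed
  have tel: "g (x s) - g (x t) = (\<Sum>k<m. partial_deriv k g ((y k s)(k := u k s)) * (x s k - x t k))" for s
  proof -
    have "(\<Sum>k<m. partial_deriv k g ((y k s)(k := u k s)) * (x s k - x t k)) = (\<Sum>k<m. g (y (Suc k) s) - g (y k s))"
      using u by (intro sum.cong) auto
    also have "\<dots> = g (y m s) - g (y 0 s)" by (rule sum_lessThan_telescope)
    also have "y 0 s = x t" by (simp add: y_def fun_eq_iff)
    also have "g (y m s) = g (x s)" by (rule C1_growth_cong[OF g]) (simp add: y_def)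
    finally show ?thesis ..
  qed
  have "((\<lambda>s. \<Sum>k<m. partial_deriv k g ((y k s)(k := u k s)) * ((x s k - x t k) / (s - t)))
      \<longlongrightarrow> (\<Sum>k<m. partial_deriv k g (x t) * x' k)) (at t)"
    using x by (intro tendsto_sum tendsto_mult lim) (auto simp: has_field_derivative_iff)
  then show ?thesis
    unfolding has_field_derivative_iff by (simp add: tel sum_divide_distrib)
qed

section \<open>Gaussian vectors in an inner product space\<close>

lemma norm_sum_scaleR_square:
  fixes u :: "'a \<Rightarrow> 'k::real_inner"
  shows "(norm (\<Sum>a\<in>A. c a *\<^sub>R u a))\<^sup>2 = (\<Sum>a\<in>A. \<Sum>b\<in>A. c a * c b * (u a \<bullet> u b))"
  by (simp add: power2_norm_eq_inner inner_sum_left inner_sum_right sum_distrib_left mult_ac inner_commute)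

text \<open>
  Only inner products enter the norm of a linear combination. This identifies norms in different
  realisations of the same tensor product.
\<close>
lemma norm_sum_scaleR_reindex:
  fixes u :: "'a \<Rightarrow> 'k::real_inner" and v :: "'b \<Rightarrow> 'l::real_inner"
  assumes "bij_betw \<pi> A B" and "\<And>a. a \<in> A \<Longrightarrow> c a = d (\<pi> a)"
    and "\<And>a b. a \<in> A \<Longrightarrow> b \<in> A \<Longrightarrow> u a \<bullet> u b = v (\<pi> a) \<bullet> v (\<pi> b)"
  shows "norm (\<Sum>a\<in>A. c a *\<^sub>R u a) = norm (\<Sum>b\<in>B. d b *\<^sub>R v b)"
proof -
  have "(norm (\<Sum>a\<in>A. c a *\<^sub>R u a))\<^sup>2 = (norm (\<Sum>b\<in>B. d b *\<^sub>R v b))\<^sup>2"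
    unfolding norm_sum_scaleR_square sum.reindex_bij_betw[OF assms(1), symmetric]
    by (intro sum.cong refl) (simp add: assms)
  then show ?thesis by simp
qed

text \<open>
  Addition in a nonseparable space can fail to be Borel measurable. Expanding the squared norm
  reduces the claim to the real coefficients.
\<close>
lemma borel_measurable_norm_sum_scaleR [measurable (raw)]:
  fixes u :: "'a \<Rightarrow> 'k::real_inner"
  assumes [measurable]: "\<And>a. a \<in> A \<Longrightarrow> c a \<in> borel_measurable N"
  shows "(\<lambda>x. norm (\<Sum>a\<in>A. c a x *\<^sub>R u a)) \<in> borel_measurable N"
proof -
  have "norm (\<Sum>a\<in>A. c a x *\<^sub>R u a) = sqrt (\<Sum>a\<in>A. \<Sum>b\<in>A. c a x * c b x * (u a \<bullet> u b))" for x
    by (simp flip: norm_sum_scaleR_square)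
  then show ?thesis by simp
qed

text \<open>
  For an inner product space \<open>K\<close>, the elements \<open>tensor_power [h] \<otimes> u\<close> of \<open>('h list, K) ell2\<close>
  have the inner products of elementary tensors in $H \otimes K$. They represent $h \otimes u$ below,
  also when \<open>K\<close> is itself such a space.
\<close>
lemma inner_tensor_single:
  "(tensor_power [h] \<otimes> u) \<bullet> (tensor_power [g] \<otimes> w) = (h \<bullet> g) * (u \<bullet> w)"
  by (simp add: inner_tensor inner_tensor_power)

text \<open>
  One Gram-Schmidt step for each vector.
\<close>
lemma finite_orthonormal_spanning:
  fixes U :: "'k::real_inner set"
  assumes "finite U"
  shows "\<exists>E. finite E \<and> orthonormal E \<and> U \<subseteq> span E"
  using assms
proof (induction U)
  case empty then show ?case by (intro exI[of _ "{}"]) (simp add: orthonormal_def)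
next
  case (insert x U)
  then obtain E where E: "finite E" "orthonormal E" "U \<subseteq> span E" by blast
  define y where "y = x - (\<Sum>e\<in>E. (x \<bullet> e) *\<^sub>R e)"
  have x: "x = y + (\<Sum>e\<in>E. (x \<bullet> e) *\<^sub>R e)" by (simp add: y_def)
  have y: "e \<bullet> y = 0" "y \<bullet> e = 0" if "e \<in> E" for e
    using that E orthonormal_inner_sum[of E E e "\<lambda>e. x \<bullet> e"]
    by (auto simp: y_def inner_diff_right inner_commute)
  have "insert x U \<subseteq> span (insert (sgn y) E)"
  proof -
    have "y = norm y *\<^sub>R sgn y" by (cases "y = 0") (simp_all add: sgn_div_norm)
    then have "y \<in> span (insert (sgn y) E)" by (metis insertI1 span_base span_scale)
    then have "x \<in> span (insert (sgn y) E)"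
      by (subst x) (intro span_add span_sum span_scale, auto intro: span_base)
    moreover have "span E \<subseteq> span (insert (sgn y) E)" by (intro span_mono) auto
    ultimately show ?thesis using E by auto
  qed
  moreover have "orthonormal (insert (sgn y) E)" if "y \<noteq> 0"
  proof -
    have "sgn y \<bullet> sgn y = 1" using that by (simp add: norm_sgn flip: power2_norm_eq_inner)
    moreover have "sgn y \<notin> E"
      using y(1)[of "sgn y"] that by (auto simp: sgn_div_norm)
    ultimately show ?thesis using E(2) y by (auto simp: orthonormal_def sgn_div_norm)
  qed
  moreover have "insert x U \<subseteq> span E" if "y = 0"
  proof -
    have "x = (\<Sum>e\<in>E. (x \<bullet> e) *\<^sub>R e)" using x that by simp
    also have "\<dots> \<in> span E" by (intro span_sum span_scale span_base)
    finally show ?thesis using E(3) by simp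
  qed
  ultimately show ?case using E(1,2) by (cases "y = 0") (blast, meson finite_insert)
qed

lemma orthonormal_span_inner:
  assumes "finite E" "orthonormal E" "x \<in> span E"
  shows "x \<bullet> y = (\<Sum>e\<in>E. (x \<bullet> e) * (y \<bullet> e))"
proof -
  obtain a where a: "x = (\<Sum>e\<in>E. a e *\<^sub>R e)" using assms by (auto simp: span_finite)
  have "x \<bullet> e = a e" if "e \<in> E" for e
    using orthonormal_inner_sum[OF assms(2,1) order_refl that] that a by (simp add: inner_commute)
  then have "(\<Sum>e\<in>E. (x \<bullet> e) * (y \<bullet> e)) = (\<Sum>e\<in>E. a e * (e \<bullet> y))" by (simp add: inner_commute)
  then show ?thesis using a by (simp add: inner_sum_left)
qed

context prob_space
begin

lemma
  fixes f :: "'a \<Rightarrow> real"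
  assumes f: "integrable M f"
  shows integrable_fst_copy: "integrable (M \<Otimes>\<^sub>M M) (\<lambda>x. f (fst x))"
    and integrable_snd_copy: "integrable (M \<Otimes>\<^sub>M M) (\<lambda>x. f (snd x))"
    and integral_fst_copy: "(LINT x|(M \<Otimes>\<^sub>M M). f (fst x)) = (LINT \<omega>|M. f \<omega>)"
    and integral_snd_copy: "(LINT x|(M \<Otimes>\<^sub>M M). f (snd x)) = (LINT \<omega>|M. f \<omega>)"
proof -
  interpret two: pair_prob_space M M ..
  have [measurable]: "f \<in> borel_measurable M" using f by auto
  have d: "distr (M \<Otimes>\<^sub>M M) M fst = M" by (rule distr_pair_fst)
  show i: "integrable (M \<Otimes>\<^sub>M M) (\<lambda>x. f (fst x))"
    using f by (subst (asm) d[symmetric]) (simp add: integrable_distr_eq)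
  show e: "(LINT x|(M \<Otimes>\<^sub>M M). f (fst x)) = (LINT \<omega>|M. f \<omega>)"
    by (subst (2) d[symmetric]) (simp add: integral_distr)
  show "integrable (M \<Otimes>\<^sub>M M) (\<lambda>x. f (snd x))"
    using two.integrable_product_swap[OF i] by (simp add: case_prod_unfold)
  show "(LINT x|(M \<Otimes>\<^sub>M M). f (snd x)) = (LINT \<omega>|M. f \<omega>)"
    using two.integral_product_swap[of "\<lambda>x. f (fst x)"] by (simp add: case_prod_unfold e)
qed

lemma integral_le_sqrt_second_moment:
  fixes f :: "'a \<Rightarrow> real"
  assumes "integrable M f" "integrable M (\<lambda>x. (f x)\<^sup>2)"
  shows "expectation f \<le> sqrt (expectation (\<lambda>x. (f x)\<^sup>2))"
  using variance_eq[OF assms] variance_positive[of f] real_le_rsqrt by simp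

text \<open>
  Jensen's inequality in the second copy, whose mean vanishes.
\<close>
lemma integral_abs_le_independent_difference:
  fixes S :: "'a \<Rightarrow> real"
  assumes S: "integrable M S" and mean: "expectation S = 0"
  shows "expectation (\<lambda>\<omega>. \<bar>S \<omega>\<bar>) \<le> (LINT x|(M \<Otimes>\<^sub>M M). \<bar>S (fst x) - S (snd x)\<bar>)"
proof -
  interpret two: pair_prob_space M M ..
  have int: "integrable (M \<Otimes>\<^sub>M M) (\<lambda>x. \<bar>S (fst x) - S (snd x)\<bar>)"
    by (intro integrable_abs Bochner_Integration.integrable_diff integrable_fst_copy integrable_snd_copy S)
  have "expectation (\<lambda>\<omega>. \<bar>S \<omega>\<bar>) \<le> (LINT \<omega>|M. LINT \<omega>'|M. \<bar>S \<omega> - S \<omega>'\<bar>)"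
  proof (rule integral_mono)
    show "integrable M (\<lambda>\<omega>. LINT \<omega>'|M. \<bar>S \<omega> - S \<omega>'\<bar>)" using two.integrable_fst'[OF int] by simp
    show "\<bar>S \<omega>\<bar> \<le> (LINT \<omega>'|M. \<bar>S \<omega> - S \<omega>'\<bar>)" for \<omega>
      using integral_abs_bound[of M "\<lambda>\<omega>'. S \<omega> - S \<omega>'"] S mean by (simp add: prob_space)
  qed (use S in simp)
  also have "\<dots> = (LINT x|(M \<Otimes>\<^sub>M M). \<bar>S (fst x) - S (snd x)\<bar>)"
    using two.integral_fst'[OF int] by simp
  finally show ?thesis .
qed

lemma integrable_power_sum:
  fixes X :: "'i \<Rightarrow> 'a \<Rightarrow> real"
  assumes "finite I" and X: "\<And>i n. i \<in> I \<Longrightarrow> integrable M (\<lambda>\<omega>. \<bar>X i \<omega>\<bar> ^ n)"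
    and [measurable]: "\<And>i. i \<in> I \<Longrightarrow> X i \<in> borel_measurable M"
  shows "integrable M (\<lambda>\<omega>. \<bar>\<Sum>i\<in>I. X i \<omega>\<bar> ^ n)"
  using assms(1) subset_refl[of I]
proof (induction I arbitrary: n rule: finite_subset_induct')
  case empty then show ?case by simp
next
  case (insert i F)
  note [measurable] = X(1)
  have F: "\<And>j. j \<in> F \<Longrightarrow> j \<in> I" using insert by auto
  have bound: "\<bar>x + y\<bar> ^ n \<le> 2 ^ n * \<bar>x\<bar> ^ n + 2 ^ n * \<bar>y\<bar> ^ n" for x y :: real
  proof -
    have "\<bar>x + y\<bar> ^ n \<le> (2 * max \<bar>x\<bar> \<bar>y\<bar>) ^ n" by (rule power_mono) auto
    also have "\<dots> \<le> 2 ^ n * \<bar>x\<bar> ^ n + 2 ^ n * \<bar>y\<bar> ^ n"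
      by (auto simp: power_mult_distrib max_def)
    finally show ?thesis .
  qed
  show ?case
  proof (rule Bochner_Integration.integrable_bound)
    show "integrable M (\<lambda>\<omega>. 2 ^ n * \<bar>X i \<omega>\<bar> ^ n + 2 ^ n * \<bar>\<Sum>j\<in>F. X j \<omega>\<bar> ^ n)"
      using insert X by (intro Bochner_Integration.integrable_add integrable_mult_right) auto
    show "AE \<omega> in M. norm (\<bar>\<Sum>j\<in>insert i F. X j \<omega>\<bar> ^ n) \<le> norm (2 ^ n * \<bar>X i \<omega>\<bar> ^ n + 2 ^ n * \<bar>\<Sum>j\<in>F. X j \<omega>\<bar> ^ n)"
      using insert.hyps bound by (auto simp: abs_of_nonneg)
    have "X j \<in> borel_measurable M" if "j \<in> insert i F" for j
      using that insert.hyps F assms(3) by auto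
    then show "(\<lambda>\<omega>. \<bar>\<Sum>j\<in>insert i F. X j \<omega>\<bar> ^ n) \<in> borel_measurable M" by measurable
  qed
qed

end

context isonormal
begin

text \<open>
  $1 + |x|$ is at most $1 + \sum_i |x_i|$. The constant 1 is included in that sum as the summand
  with index \<open>None\<close>, so that \<open>integrable_power_sum\<close> applies to it as a whole.
\<close>
lemma integrable_polynomial_growth:
  assumes [measurable]: "continuous_on UNIV g" and "polynomial_growth m g"
  shows "integrable M (\<lambda>\<omega>. g (\<lambda>i. W (h i) \<omega>))"
proof -
  obtain C N where C: "\<And>x. \<bar>g x\<bar> \<le> C * (1 + L2_set x {..<m}) ^ N"
    using assms(2) by (auto simp: polynomial_growth_def)
  have "(\<lambda>\<omega> i. W (h i) \<omega>) \<in> borel_measurable M"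
    by (rule measurable_coordinatewise_then_product) simp
  moreover have "g \<in> borel_measurable borel"
    using assms(1) by (rule borel_measurable_continuous_onI)
  ultimately have meas: "(\<lambda>\<omega>. g (\<lambda>i. W (h i) \<omega>)) \<in> borel_measurable M"
    by (rule measurable_compose)
  have int: "integrable M (\<lambda>\<omega>. \<bar>\<Sum>i\<in>insert None (Some ` {..<m}). case i of None \<Rightarrow> 1 | Some i \<Rightarrow> \<bar>W (h i) \<omega>\<bar>\<bar> ^ N)"
    by (rule integrable_power_sum) (auto intro!: centered_gaussian_facts(1)[OF gaussian_W])
  show ?thesis
  proof (rule Bochner_Integration.integrable_bound[OF integrable_mult_right[OF int, of "\<bar>C\<bar>"] meas], rule AE_I2)
    fix \<omega>
    let ?r = "\<Sum>i\<in>insert None (Some ` {..<m}). case i of None \<Rightarrow> 1 | Some i \<Rightarrow> \<bar>W (h i) \<omega>\<bar>"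
    have r: "?r = 1 + (\<Sum>i<m. \<bar>W (h i) \<omega>\<bar>)" by (subst sum.insert) (auto simp: sum.reindex)
    have "\<bar>g (\<lambda>i. W (h i) \<omega>)\<bar> \<le> \<bar>C\<bar> * \<bar>?r\<bar> ^ N"
    proof (rule order_trans[OF C mult_mono])
      show "(1 + L2_set (\<lambda>i. W (h i) \<omega>) {..<m}) ^ N \<le> \<bar>?r\<bar> ^ N"
        unfolding r using L2_set_le_sum_abs[of "\<lambda>i. W (h i) \<omega>" "{..<m}"] by (intro power_mono) auto
    qed auto
    then show "norm (g (\<lambda>i. W (h i) \<omega>)) \<le> norm (\<bar>C\<bar> * \<bar>?r\<bar> ^ N)" by (simp add: abs_mult power_abs)
  qed
qed

lemma integrable_norm_sum_scaleR:
  fixes u :: "'q \<Rightarrow> 'k::real_inner"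
  assumes "finite Q" "\<And>q. q \<in> Q \<Longrightarrow> integrable M (c q)"
  shows "integrable M (\<lambda>\<omega>. norm (\<Sum>q\<in>Q. c q \<omega> *\<^sub>R u q))"
proof (rule Bochner_Integration.integrable_bound)
  show "integrable M (\<lambda>\<omega>. \<Sum>q\<in>Q. \<bar>c q \<omega>\<bar> * norm (u q))" using assms by auto
  show "(\<lambda>\<omega>. norm (\<Sum>q\<in>Q. c q \<omega> *\<^sub>R u q)) \<in> borel_measurable M"
    using assms by (intro borel_measurable_norm_sum_scaleR) auto
  have "norm (\<Sum>q\<in>Q. c q \<omega> *\<^sub>R u q) \<le> (\<Sum>q\<in>Q. \<bar>c q \<omega>\<bar> * norm (u q))" for \<omega>
    by (rule sum_norm_le) simp
  then show "AE \<omega> in M. norm (norm (\<Sum>q\<in>Q. c q \<omega> *\<^sub>R u q)) \<le> norm (\<Sum>q\<in>Q. \<bar>c q \<omega>\<bar> * norm (u q))"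
    by (auto intro!: AE_I2 order_trans[OF _ abs_ge_self])
qed

lemma integrable_W: "integrable M (W h)"
  using centered_gaussian_facts(1)[OF gaussian_W, of h 1] by (simp add: integrable_abs_iff)

text \<open>
  The right-hand side is the square root of the second moment of the Gaussian vector on the left.
\<close>
lemma gaussian_vector_upper:
  fixes u :: "'q \<Rightarrow> 'k::real_inner"
  assumes Q: "finite Q"
  shows "(LINT \<omega>|M. norm (\<Sum>q\<in>Q. (c q * W (k q) \<omega>) *\<^sub>R u q)) \<le> norm (\<Sum>q\<in>Q. c q *\<^sub>R (tensor_power [k q] \<otimes> u q))"
proof -
  let ?f = "\<lambda>\<omega>. norm (\<Sum>q\<in>Q. (c q * W (k q) \<omega>) *\<^sub>R u q)"
  have sq: "(?f \<omega>)\<^sup>2 = (\<Sum>q\<in>Q. \<Sum>r\<in>Q. (W (k q) \<omega> * W (k r) \<omega>) * (c q * c r * (u q \<bullet> u r)))" for \<omega>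
    unfolding norm_sum_scaleR_square by (simp add: mult_ac)
  have "(LINT \<omega>|M. ?f \<omega>) \<le> sqrt (LINT \<omega>|M. (?f \<omega>)\<^sup>2)"
    by (rule integral_le_sqrt_second_moment)
      (use Q in \<open>auto simp only: sq intro!: integrable_norm_sum_scaleR integrable_mult_right integrable_W integrable_sum
        integrable_mult_left integrable_W_mult\<close>)
  also have "(LINT \<omega>|M. (?f \<omega>)\<^sup>2) = (\<Sum>q\<in>Q. \<Sum>r\<in>Q. (k q \<bullet> k r) * (c q * c r * (u q \<bullet> u r)))"
    unfolding sq by (simp add: integrable_W_mult integral_W_mult)
  also have "\<dots> = (norm (\<Sum>q\<in>Q. c q *\<^sub>R (tensor_power [k q] \<otimes> u q)))\<^sup>2"
    unfolding norm_sum_scaleR_square inner_tensor_single by (simp add: mult_ac)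
  finally show ?thesis by simp
qed

text \<open>
  Let \<open>e\<close> range over a finite orthonormal family whose span contains the vectors \<open>u q\<close>, let $\sigma_e$ be the
  standard deviation of the component along \<open>e\<close> of one copy of the Gaussian vector, and let \<open>s\<close> be
  the norm on the left, so that $s^2 = \sum_e \sigma_e^2$. By Cauchy-Schwarz with the weights
  $\sigma_e$, the norm of the difference $D$ of the two copies satisfies
  $s\,\|D\| \ge \sum_e \sigma_e |\langle D, e\rangle|$. The component of $D$ along \<open>e\<close> has $L^1$ norm at
  least $\sqrt{2/\pi}\,\sigma_e$, so the expectation of the sum is at least $\sqrt{2/\pi}\,s^2$: no dimension enters.
\<close>
lemma gaussian_vector_lower:
  fixes u :: "'q \<Rightarrow> 'k::real_inner"
  assumes Q: "finite Q"
  shows "sqrt (2 / pi) * norm (\<Sum>q\<in>Q. c q *\<^sub>R (tensor_power [k q] \<otimes> u q))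
    \<le> (LINT x|(M \<Otimes>\<^sub>M M). norm (\<Sum>q\<in>Q. (c q * (W (k q) (fst x) - W (k q) (snd x))) *\<^sub>R u q))"
proof -
  obtain E where E: "finite E" "orthonormal E" "u ` Q \<subseteq> span E"
    using finite_orthonormal_spanning[of "u ` Q"] Q by auto
  define S where "S e \<omega> = (\<Sum>q\<in>Q. c q * (u q \<bullet> e) * W (k q) \<omega>)" for e \<omega>
  define \<sigma> where "\<sigma> e = norm (\<Sum>q\<in>Q. (c q * (u q \<bullet> e)) *\<^sub>R k q)" for e
  define s where "s = norm (\<Sum>q\<in>Q. c q *\<^sub>R (tensor_power [k q] \<otimes> u q))"
  define D where "D x = (\<Sum>q\<in>Q. (c q * (W (k q) (fst x) - W (k q) (snd x))) *\<^sub>R u q)" for x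
  have s2: "s\<^sup>2 = (\<Sum>e\<in>E. (\<sigma> e)\<^sup>2)"
  proof -
    have "s\<^sup>2 = (\<Sum>q\<in>Q. \<Sum>r\<in>Q. c q * c r * ((k q \<bullet> k r) * (\<Sum>e\<in>E. (u q \<bullet> e) * (u r \<bullet> e))))"
      unfolding s_def norm_sum_scaleR_square inner_tensor_single
      by (intro sum.cong refl) (use E in \<open>auto simp: orthonormal_span_inner[OF E(1,2)]\<close>)
    also have "\<dots> = (\<Sum>q\<in>Q. \<Sum>r\<in>Q. \<Sum>e\<in>E. (c q * (u q \<bullet> e)) * (c r * (u r \<bullet> e)) * (k q \<bullet> k r))"
      by (simp add: sum_distrib_left mult_ac)
    also have "\<dots> = (\<Sum>q\<in>Q. \<Sum>e\<in>E. \<Sum>r\<in>Q. (c q * (u q \<bullet> e)) * (c r * (u r \<bullet> e)) * (k q \<bullet> k r))"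
      by (intro sum.cong refl sum.swap)
    also have "\<dots> = (\<Sum>e\<in>E. \<Sum>q\<in>Q. \<Sum>r\<in>Q. (c q * (u q \<bullet> e)) * (c r * (u r \<bullet> e)) * (k q \<bullet> k r))"
      by (rule sum.swap)
    finally show ?thesis by (simp only: \<sigma>_def norm_sum_scaleR_square)
  qed
  have intD: "integrable (M \<Otimes>\<^sub>M M) (\<lambda>x. norm (D x))"
  proof (rule Bochner_Integration.integrable_bound)
    show "integrable (M \<Otimes>\<^sub>M M) (\<lambda>x. \<Sum>q\<in>Q. \<bar>c q * (W (k q) (fst x) - W (k q) (snd x))\<bar> * norm (u q))"
      using integrable_fst_copy[OF integrable_W] integrable_snd_copy[OF integrable_W] by auto
    show "(\<lambda>x. norm (D x)) \<in> borel_measurable (M \<Otimes>\<^sub>M M)" unfolding D_def by measurable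
    have "norm (D x) \<le> (\<Sum>q\<in>Q. \<bar>c q * (W (k q) (fst x) - W (k q) (snd x))\<bar> * norm (u q))" for x
      unfolding D_def by (rule sum_norm_le) (simp add: abs_mult)
    then show "AE x in M \<Otimes>\<^sub>M M. norm (norm (D x)) \<le> norm (\<Sum>q\<in>Q. \<bar>c q * (W (k q) (fst x) - W (k q) (snd x))\<bar> * norm (u q))"
      by (auto intro!: AE_I2 order_trans[OF _ abs_ge_self])
  qed
  have Se: "integrable M (S e)" "(LINT \<omega>|M. S e \<omega>) = 0" "(LINT \<omega>|M. \<bar>S e \<omega>\<bar>) = sqrt (2 / pi) * \<sigma> e" for e
  proof -
    have g: "centered_gaussian_rv M (S e)"
      unfolding S_def[abs_def] using gaussian_sum[OF Q] .
    show "integrable M (S e)" unfolding S_def using integrable_W by (auto simp: mult.assoc)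
    show "(LINT \<omega>|M. S e \<omega>) = 0" by (rule centered_gaussian_facts(2)[OF g])
    have "(LINT \<omega>|M. (S e \<omega>)\<^sup>2) = (\<sigma> e)\<^sup>2"
      unfolding S_def \<sigma>_def using second_moment_sum[OF Q] .
    then show "(LINT \<omega>|M. \<bar>S e \<omega>\<bar>) = sqrt (2 / pi) * \<sigma> e"
      using centered_gaussian_facts(3)[OF g] by (simp add: \<sigma>_def)
  qed
  have Dspan: "D x \<in> span E" for x
    unfolding D_def using E(3) by (auto intro!: span_sum span_scale)
  have De: "D x \<bullet> e = S e (fst x) - S e (snd x)" for x e
    unfolding D_def S_def inner_sum_left
    by (simp add: algebra_simps flip: sum_subtractf)
  have CS: "(\<Sum>e\<in>E. \<sigma> e * \<bar>S e (fst x) - S e (snd x)\<bar>) \<le> s * norm (D x)" for x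
  proof -
    have "(\<Sum>e\<in>E. \<bar>\<sigma> e\<bar> * \<bar>D x \<bullet> e\<bar>) \<le> L2_set \<sigma> E * L2_set (\<lambda>e. D x \<bullet> e) E"
      by (rule L2_set_mult_ineq)
    also have "L2_set (\<lambda>e. D x \<bullet> e) E = norm (D x)"
      using orthonormal_span_inner[OF E(1,2) Dspan, of x "D x"]
      by (simp add: L2_set_def norm_eq_sqrt_inner power2_eq_square)
    also have "L2_set \<sigma> E = s" unfolding L2_set_def s2[symmetric] by (simp add: s_def)
    finally show ?thesis by (simp add: De \<sigma>_def)
  qed
  have "s * (sqrt (2 / pi) * s) = sqrt (2 / pi) * (\<Sum>e\<in>E. (\<sigma> e)\<^sup>2)"
    unfolding s2[symmetric] by (simp add: power2_eq_square)
  also have "\<dots> = (\<Sum>e\<in>E. \<sigma> e * (LINT \<omega>|M. \<bar>S e \<omega>\<bar>))"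
    by (simp add: Se power2_eq_square sum_distrib_left mult_ac)
  also have "\<dots> \<le> (\<Sum>e\<in>E. \<sigma> e * (LINT x|(M \<Otimes>\<^sub>M M). \<bar>S e (fst x) - S e (snd x)\<bar>))"
    by (intro sum_mono mult_left_mono integral_abs_le_independent_difference Se) (simp add: \<sigma>_def)
  also have "\<dots> = (LINT x|(M \<Otimes>\<^sub>M M). (\<Sum>e\<in>E. \<sigma> e * \<bar>S e (fst x) - S e (snd x)\<bar>))"
    using integrable_fst_copy[OF Se(1)] integrable_snd_copy[OF Se(1)] by simp
  also have "\<dots> \<le> (LINT x|(M \<Otimes>\<^sub>M M). s * norm (D x))"
    using integrable_fst_copy[OF Se(1)] integrable_snd_copy[OF Se(1)] intD CS by (intro integral_mono) auto
  finally have "s * (sqrt (2 / pi) * s) \<le> s * (LINT x|(M \<Otimes>\<^sub>M M). norm (D x))" by simp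
  then have "sqrt (2 / pi) * s \<le> (LINT x|(M \<Otimes>\<^sub>M M). norm (D x))"
    by (cases "s = 0") (auto simp: s_def mult_le_cancel_left)
  then show ?thesis by (simp add: s_def D_def)
qed

end

section \<open>The Poincare inequality in $L^1$\<close>

text \<open>
  The argument \<open>z\<close> is a sample of the whole process, and every summand reads off it its own
  sequence of coordinates. A sum of functionals with unrelated representations is thus of the same form.
\<close>
definition cyl ::
    "'p set \<Rightarrow> ('p \<Rightarrow> (nat \<Rightarrow> real) \<Rightarrow> real) \<Rightarrow> ('p \<Rightarrow> nat \<Rightarrow> 'h) \<Rightarrow> ('p \<Rightarrow> 'k::real_vector) \<Rightarrow> ('h \<Rightarrow> real) \<Rightarrow> 'k" where
  "cyl P g h u z = (\<Sum>p\<in>P. g p (\<lambda>j. z (h p j)) *\<^sub>R u p)"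

text \<open>
  The derivative is again of the form \<open>cyl\<close>, over pairs of a summand and a direction,
  so that it can be differentiated again.
\<close>
definition dcyl ::
    "'p set \<Rightarrow> ('p \<Rightarrow> nat) \<Rightarrow> ('p \<Rightarrow> (nat \<Rightarrow> real) \<Rightarrow> real) \<Rightarrow> ('p \<Rightarrow> nat \<Rightarrow> 'h::{real_inner, second_countable_topology})
      \<Rightarrow> ('p \<Rightarrow> 'k::real_inner) \<Rightarrow> ('h \<Rightarrow> real) \<Rightarrow> ('h list, 'k) ell2" where
  "dcyl P m g h u = cyl (SIGMA p:P. {..<m p}) (\<lambda>(p, i). partial_deriv i (g p)) (\<lambda>(p, i). h p)
      (\<lambda>(p, i). tensor_power [h p i] \<otimes> u p)"

lemma cyl_Sigma:
  assumes "finite P" and "\<And>p. p \<in> P \<Longrightarrow> finite (A p)"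
  shows "cyl (Sigma P A) g h u z = (\<Sum>p\<in>P. \<Sum>i\<in>A p. g (p, i) (\<lambda>j. z (h (p, i) j)) *\<^sub>R u (p, i))"
  using assms by (simp add: cyl_def sum.Sigma case_prod_unfold)

lemma inner_sgn: "x \<bullet> sgn x = norm (x :: 'k::real_inner)"
  by (cases "x = 0") (simp_all add: sgn_div_norm power2_norm_eq_inner[symmetric] power2_eq_square)

context isonormal
begin

abbreviation sample :: "'w \<Rightarrow> 'h \<Rightarrow> real" where "sample \<omega> \<equiv> \<lambda>h. W h \<omega>"

lemma rot_0: "rot 0 x = sample (fst x)" and rot_pi_half: "rot (pi / 2) x = sample (snd x)"
  by (simp_all add: rot_def fun_eq_iff)

lemma integrable_norm_cyl:
  assumes "finite P" and "\<And>p. p \<in> P \<Longrightarrow> C1_growth (m p) (g p)"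
  shows "integrable M (\<lambda>\<omega>. norm (cyl P g h u (sample \<omega>) :: 'k::real_inner))"
  unfolding cyl_def
  by (rule integrable_norm_sum_scaleR)
    (use assms in \<open>auto simp: C1_growth_def intro!: integrable_polynomial_growth\<close>)

lemma integrable_norm_dcyl:
  assumes "finite P" and "\<And>p. p \<in> P \<Longrightarrow> C1_growth (m p) (g p)"
  shows "integrable M (\<lambda>\<omega>. norm (dcyl P m g h u (sample \<omega>)))"
  unfolding dcyl_def cyl_def
  by (rule integrable_norm_sum_scaleR)
    (use assms in \<open>auto simp: C1_growth_def intro!: integrable_polynomial_growth\<close>)

lemma integrable_norm_diff_copies:
  fixes G :: "('h \<Rightarrow> real) \<Rightarrow> 'k::real_inner"
  assumes "integrable M (\<lambda>\<omega>. norm (G (sample \<omega>)))"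
    and [measurable]: "(\<lambda>x. norm (G (sample (fst x)) - G (sample (snd x)))) \<in> borel_measurable (M \<Otimes>\<^sub>M M)"
  shows "integrable (M \<Otimes>\<^sub>M M) (\<lambda>x. norm (G (sample (fst x)) - G (sample (snd x))))"
proof (rule Bochner_Integration.integrable_bound)
  show "integrable (M \<Otimes>\<^sub>M M) (\<lambda>x. norm (G (sample (fst x))) + norm (G (sample (snd x))))"
    using integrable_fst_copy[OF assms(1)] integrable_snd_copy[OF assms(1)] by simp
  show "AE x in M \<Otimes>\<^sub>M M. norm (norm (G (sample (fst x)) - G (sample (snd x)))) \<le> norm (norm (G (sample (fst x))) + norm (G (sample (snd x))))"
    by (simp add: norm_triangle_ineq4)
qed measurable

lemma cyl_diff_copies:
  "cyl P g h u (sample (fst x)) - cyl P g h u (sample (snd x))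
    = (\<Sum>p\<in>P. (g p (\<lambda>j. W (h p j) (fst x)) - g p (\<lambda>j. W (h p j) (snd x))) *\<^sub>R u p)"
  by (simp add: cyl_def scaleR_left_diff_distrib sum_subtractf)

lemma measurable_norm_cyl_diff_copies:
  fixes u :: "'p \<Rightarrow> 'k::real_inner"
  assumes "\<And>p. p \<in> P \<Longrightarrow> continuous_on UNIV (g p)"
  shows "(\<lambda>x. norm (cyl P g h u (sample (fst x)) - cyl P g h u (sample (snd x)))) \<in> borel_measurable (M \<Otimes>\<^sub>M M)"
  unfolding cyl_diff_copies
proof (rule borel_measurable_norm_sum_scaleR)
  fix p assume p: "p \<in> P"
  note [measurable] = borel_measurable_continuous_onI[OF assms(1)[OF p]]
  have [measurable]: "(\<lambda>x j. W (h p j) (fst x)) \<in> borel_measurable (M \<Otimes>\<^sub>M M)"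
    "(\<lambda>x j. W (h p j) (snd x)) \<in> borel_measurable (M \<Otimes>\<^sub>M M)"
    by (rule measurable_coordinatewise_then_product; simp)+
  show "(\<lambda>x. g p (\<lambda>j. W (h p j) (fst x)) - g p (\<lambda>j. W (h p j) (snd x))) \<in> borel_measurable (M \<Otimes>\<^sub>M M)"
    by measurable
qed

lemma integrable_norm_cyl_diff_copies:
  fixes u :: "'p \<Rightarrow> 'k::real_inner"
  assumes "finite P" and "\<And>p. p \<in> P \<Longrightarrow> C1_growth (m p) (g p)"
  shows "integrable (M \<Otimes>\<^sub>M M) (\<lambda>x. norm (cyl P g h u (sample (fst x)) - cyl P g h u (sample (snd x))))"
  using assms by (intro integrable_norm_diff_copies integrable_norm_cyl measurable_norm_cyl_diff_copies)
    (auto simp: C1_growth_def)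

text \<open>
  The integral over the rotation is exchanged with the expectation. By rotation invariance the inner expectation is the same
  for all angles, so the length $\pi/2$ of the interval comes out as a factor.
\<close>
lemma poincare_inequality_nn:
  fixes u :: "'p \<Rightarrow> 'k::real_inner"
  assumes P: "finite P" and g: "\<And>p. p \<in> P \<Longrightarrow> C1_growth (m p) (g p)"
  shows "(\<integral>\<^sup>+x. ennreal (norm (cyl P g h u (sample (fst x)) - cyl P g h u (sample (snd x)))) \<partial>(M \<Otimes>\<^sub>M M))
    \<le> ennreal (pi / 2) * (\<integral>\<^sup>+\<omega>. ennreal (norm (dcyl P m g h u (sample \<omega>))) \<partial>M)"
proof -
  define Q where "Q = (SIGMA p:P. {..<m p})"
  define k where "k = (\<lambda>(p, i). h p i)"
  define c where "c = (\<lambda>(p, i) z. partial_deriv i (g p) (\<lambda>j. z (h p j)))"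
  define uu where "uu = (\<lambda>(p, i :: nat). u p)"
  define \<Psi> where "\<Psi> z z' = (\<Sum>q\<in>Q. (c q z * z' (k q)) *\<^sub>R uu q)" for z z'
  have Q: "finite Q" using P by (auto simp: Q_def)
  have pd_cont: "continuous_on UNIV (partial_deriv i (g p))" if "(p, i) \<in> Q" for p i
    using that g by (auto simp: Q_def C1_growth_def)
  have dcyl_eq: "dcyl P m g h u z = (\<Sum>q\<in>Q. c q z *\<^sub>R (tensor_power [k q] \<otimes> uu q))" for z
    by (simp add: dcyl_def cyl_def Q_def c_def k_def uu_def case_prod_unfold)
  have c_meas: "(\<lambda>x. c q (z x)) \<in> borel_measurable N"
    if q: "q \<in> Q" and [measurable]: "\<And>p j. p \<in> P \<Longrightarrow> (\<lambda>x. z x (h p j)) \<in> borel_measurable N" for q z and N :: "'c measure"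
  proof -
    obtain p i where pi: "q = (p, i)" "p \<in> P" using q by (auto simp: Q_def)
    have "(\<lambda>x j. z x (h p j)) \<in> borel_measurable N"
      by (rule measurable_coordinatewise_then_product) (use pi in simp)
    with borel_measurable_continuous_onI[OF pd_cont] q
    show ?thesis by (auto simp: pi c_def intro: measurable_compose)
  qed
  have pathwise: "ennreal (norm (cyl P g h u (sample (fst x)) - cyl P g h u (sample (snd x))))
      \<le> (\<integral>\<^sup>+\<theta>. ennreal (norm (\<Psi> (rot \<theta> x) (rot (\<theta> + pi / 2) x))) * indicator {0..pi / 2} \<theta> \<partial>lborel)" for x
  proof -
    \<comment> \<open>Pairing with the direction of the increment reduces the path to a real function, with the same increment.\<close>
    define e where "e = sgn (cyl P g h u (sample (snd x)) - cyl P g h u (sample (fst x)))"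
    define F where "F \<theta> = cyl P g h u (rot \<theta> x) \<bullet> e" for \<theta>
    define f where "f \<theta> = \<Psi> (rot \<theta> x) (rot (\<theta> + pi / 2) x) \<bullet> e" for \<theta>
    have rot_der: "((\<lambda>\<theta>. rot \<theta> x a) has_real_derivative rot (\<theta> + pi / 2) x a) (at \<theta>)" for a \<theta>
      unfolding rot_def by (auto intro!: derivative_eq_intros simp: cos_add sin_add)
    have rot_cont: "continuous_on UNIV (\<lambda>\<theta>. rot (\<theta> + b) x a)" for a b
      unfolding rot_def by (intro continuous_intros)
    have F_der: "(F has_real_derivative f \<theta>) (at \<theta>)" for \<theta>
    proof -
      have "((\<lambda>\<theta>. g p (\<lambda>j. rot \<theta> x (h p j))) has_real_derivative
          (\<Sum>i<m p. partial_deriv i (g p) (\<lambda>j. rot \<theta> x (h p j)) * rot (\<theta> + pi / 2) x (h p i))) (at \<theta>)"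
        if "p \<in> P" for p
        by (rule C1_growth_chain_rule[OF g[OF that]]) (rule rot_der)
      then have "((\<lambda>\<theta>. \<Sum>p\<in>P. g p (\<lambda>j. rot \<theta> x (h p j)) * (u p \<bullet> e)) has_real_derivative
          (\<Sum>p\<in>P. (\<Sum>i<m p. partial_deriv i (g p) (\<lambda>j. rot \<theta> x (h p j)) * rot (\<theta> + pi / 2) x (h p i)) * (u p \<bullet> e))) (at \<theta>)"
        by (intro DERIV_sum DERIV_cmult_right) auto
      moreover have "(\<lambda>\<theta>. \<Sum>p\<in>P. g p (\<lambda>j. rot \<theta> x (h p j)) * (u p \<bullet> e)) = F"
        by (simp add: F_def cyl_def inner_sum_left fun_eq_iff)
      moreover have "(\<Sum>p\<in>P. (\<Sum>i<m p. partial_deriv i (g p) (\<lambda>j. rot \<theta> x (h p j)) * rot (\<theta> + pi / 2) x (h p i)) * (u p \<bullet> e)) = f \<theta>"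
        using P by (simp add: f_def \<Psi>_def Q_def c_def k_def uu_def inner_sum_left sum_distrib_right
            sum.Sigma case_prod_unfold)
      ultimately show ?thesis by simp
    qed
    have f_cont: "continuous_on UNIV f"
    proof -
      have c_cont: "continuous_on UNIV (\<lambda>\<theta>. c q (rot \<theta> x))" if "q \<in> Q" for q
      proof (cases q)
        case (Pair p i)
        have "continuous_on UNIV (\<lambda>\<theta> j. rot \<theta> x (h p j))"
          using rot_cont[of 0] by (intro continuous_on_coordinatewise_then_product) simp
        from continuous_on_compose2[OF pd_cont this] that Pair show ?thesis by (simp add: c_def)
      qed
      show ?thesis unfolding f_def \<Psi>_def inner_sum_left inner_scaleR_left
        by (intro continuous_intros c_cont rot_cont)
    qed
    have hb: "has_bochner_integral lborel (\<lambda>\<theta>. f \<theta> * indicator {0..pi / 2} \<theta>) (F (pi / 2) - F 0)"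
      by (rule has_bochner_integral_FTC_Icc_real)
        (use F_der f_cont in \<open>auto simp: continuous_on_eq_continuous_at\<close>)
    have "norm (cyl P g h u (sample (fst x)) - cyl P g h u (sample (snd x))) = F (pi / 2) - F 0"
      unfolding F_def rot_0 rot_pi_half inner_diff_left[symmetric] e_def
      by (simp add: inner_sgn norm_minus_commute)
    also have "ennreal (F (pi / 2) - F 0) \<le> ennreal (norm (LBINT \<theta>. f \<theta> * indicator {0..pi / 2} \<theta>))"
      using has_bochner_integral_integral_eq[OF hb] by (simp add: ennreal_leI)
    also have "\<dots> \<le> (\<integral>\<^sup>+\<theta>. ennreal (norm (f \<theta> * indicator {0..pi / 2} \<theta>)) \<partial>lborel)"
      using hb by (intro integral_norm_bound_ennreal) (auto simp: has_bochner_integral_iff)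
    also have "\<dots> \<le> (\<integral>\<^sup>+\<theta>. ennreal (norm (\<Psi> (rot \<theta> x) (rot (\<theta> + pi / 2) x))) * indicator {0..pi / 2} \<theta> \<partial>lborel)"
    proof (rule nn_integral_mono)
      fix \<theta> :: real
      have "norm e \<le> 1" by (simp add: e_def norm_sgn)
      then have "\<bar>f \<theta>\<bar> \<le> norm (\<Psi> (rot \<theta> x) (rot (\<theta> + pi / 2) x))"
        unfolding f_def by (rule order_trans[OF Cauchy_Schwarz_ineq2 mult_left_le]) simp
      then show "ennreal (norm (f \<theta> * indicator {0..pi / 2} \<theta>)) \<le> ennreal (norm (\<Psi> (rot \<theta> x) (rot (\<theta> + pi / 2) x))) * indicator {0..pi / 2} \<theta>"
        by (auto simp: indicator_def ennreal_leI)
    qed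
    finally show ?thesis .
  qed
  interpret L: pair_sigma_finite lborel "M \<Otimes>\<^sub>M M" ..
  have joint: "(\<lambda>(\<theta>, x). ennreal (norm (\<Psi> (rot \<theta> x) (rot (\<theta> + pi / 2) x))) * indicator {0..pi / 2} \<theta>)
      \<in> borel_measurable (lborel \<Otimes>\<^sub>M (M \<Otimes>\<^sub>M M))"
  proof -
    have [measurable]: "(\<lambda>y. rot (fst y + b) (snd y) a) \<in> borel_measurable (lborel \<Otimes>\<^sub>M (M \<Otimes>\<^sub>M M))" for a b
      unfolding rot_def by measurable
    have [measurable]: "(\<lambda>y. norm (\<Psi> (rot (fst y) (snd y)) (rot (fst y + pi / 2) (snd y)))) \<in> borel_measurable (lborel \<Otimes>\<^sub>M (M \<Otimes>\<^sub>M M))"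
      unfolding \<Psi>_def
    proof (rule borel_measurable_norm_sum_scaleR)
      fix q assume "q \<in> Q"
      then have [measurable]: "(\<lambda>y. c q (rot (fst y) (snd y))) \<in> borel_measurable (lborel \<Otimes>\<^sub>M (M \<Otimes>\<^sub>M M))"
        by (rule c_meas) (use \<open>\<And>b a. (\<lambda>y. rot (fst y + b) (snd y) a) \<in> _\<close>[of 0] in simp)
      show "(\<lambda>y. c q (rot (fst y) (snd y)) * rot (fst y + pi / 2) (snd y) (k q)) \<in> borel_measurable (lborel \<Otimes>\<^sub>M (M \<Otimes>\<^sub>M M))"
        by measurable
    qed
    show ?thesis unfolding case_prod_unfold by measurable
  qed
  have invariant: "(\<integral>\<^sup>+x. ennreal (norm (\<Psi> (rot \<theta> x) (rot (\<theta> + pi / 2) x))) \<partial>(M \<Otimes>\<^sub>M M))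
      = (\<integral>\<^sup>+x. ennreal (norm (\<Psi> (sample (fst x)) (sample (snd x)))) \<partial>(M \<Otimes>\<^sub>M M))" for \<theta>
  proof -
    define S where "S = k ` Q"
    \<comment> \<open>Outside the finite set \<open>S\<close> the coordinates of \<open>z\<close> are unspecified; the functions read only those in \<open>S\<close>.\<close>
    define r where "r z a = (if a \<in> S then z (a, False) else 0)" for z :: "'h \<times> bool \<Rightarrow> real" and a
    define \<Phi> where "\<Phi> z = ennreal (norm (\<Psi> (r z) (\<lambda>a. z (a, True))))" for z
    have S: "finite S" using Q by (simp add: S_def)
    have rm: "(\<lambda>z. r z a) \<in> borel_measurable (PiM (S \<times> UNIV) (\<lambda>_. borel))" for a
      by (cases "a \<in> S") (simp_all add: r_def)
    have "\<Phi> \<in> borel_measurable (PiM (S \<times> UNIV) (\<lambda>_. borel))"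
      unfolding \<Phi>_def \<Psi>_def
    proof (intro measurable_compose[OF _ measurable_ennreal] borel_measurable_norm_sum_scaleR borel_measurable_times)
      fix q assume q: "q \<in> Q"
      show "(\<lambda>z. c q (r z)) \<in> borel_measurable (PiM (S \<times> UNIV) (\<lambda>_. borel))" using q rm by (rule c_meas)
      show "(\<lambda>z. z (k q, True)) \<in> borel_measurable (PiM (S \<times> UNIV) (\<lambda>_. borel))"
        using q by (intro measurable_component_singleton) (auto simp: S_def)
    qed
    note inv = rotation_invariance[OF S this, of \<theta>]
    have loc: "\<Phi> (\<lambda>(h, b)\<in>S \<times> UNIV. y b h) = ennreal (norm (\<Psi> (y False) (y True)))" for y :: "bool \<Rightarrow> 'h \<Rightarrow> real"
    proof -
      have "c q (r (\<lambda>(h, b)\<in>S \<times> UNIV. y b h)) = c q (y False)" if q: "q \<in> Q" for q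
      proof -
        obtain p i where pi: "q = (p, i)" "p \<in> P" "i < m p" using q by (auto simp: Q_def)
        have "h p j \<in> S" if "j < m p" for j
          using that pi by (auto simp: S_def Q_def k_def intro!: image_eqI[of _ _ "(p, j)"])
        then show ?thesis unfolding pi(1) c_def prod.case
          by (intro C1_growth_partial_deriv_cong[OF g[OF pi(2)] pi(3)]) (simp add: r_def)
      qed
      moreover have "k q \<in> S" if "q \<in> Q" for q using that by (simp add: S_def)
      ultimately show ?thesis unfolding \<Phi>_def \<Psi>_def by (auto intro!: arg_cong[of _ _ norm] sum.cong)
    qed
    have "\<Phi> (\<lambda>(h, b)\<in>S \<times> UNIV. rot (if b then \<theta> + pi / 2 else \<theta>) x h)
        = ennreal (norm (\<Psi> (rot \<theta> x) (rot (\<theta> + pi / 2) x)))"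
      "\<Phi> (\<lambda>(h, b)\<in>S \<times> UNIV. W h (if b then snd x else fst x))
        = ennreal (norm (\<Psi> (sample (fst x)) (sample (snd x))))" for x
      using loc[of "\<lambda>b. rot (if b then \<theta> + pi / 2 else \<theta>) x"]
        loc[of "\<lambda>b. sample (if b then snd x else fst x)"] by simp_all
    then show ?thesis using inv by (simp only:)
  qed
  have gauss: "(\<integral>\<^sup>+x. ennreal (norm (\<Psi> (sample (fst x)) (sample (snd x)))) \<partial>(M \<Otimes>\<^sub>M M))
      \<le> (\<integral>\<^sup>+\<omega>. ennreal (norm (dcyl P m g h u (sample \<omega>))) \<partial>M)"
  proof -
    have c2 [measurable]: "(\<lambda>\<omega>. c q (sample \<omega>)) \<in> borel_measurable M" if "q \<in> Q" for q
      using that by (rule c_meas) simp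
    have "(\<lambda>x. norm (\<Psi> (sample (fst x)) (sample (snd x)))) \<in> borel_measurable (M \<Otimes>\<^sub>M M)"
      unfolding \<Psi>_def
      by (rule borel_measurable_norm_sum_scaleR) (auto intro!: borel_measurable_times measurable_compose[OF measurable_fst c2])
    then have "(\<integral>\<^sup>+x. ennreal (norm (\<Psi> (sample (fst x)) (sample (snd x)))) \<partial>(M \<Otimes>\<^sub>M M))
        = (\<integral>\<^sup>+\<omega>. \<integral>\<^sup>+\<omega>'. ennreal (norm (\<Psi> (sample \<omega>) (sample \<omega>'))) \<partial>M \<partial>M)"
      by (subst nn_integral_fst[symmetric]) auto
    also have "\<dots> \<le> (\<integral>\<^sup>+\<omega>. ennreal (norm (dcyl P m g h u (sample \<omega>))) \<partial>M)"
    proof (rule nn_integral_mono)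
      fix \<omega>
      have "(\<integral>\<^sup>+\<omega>'. ennreal (norm (\<Psi> (sample \<omega>) (sample \<omega>'))) \<partial>M) = ennreal (LINT \<omega>'|M. norm (\<Psi> (sample \<omega>) (sample \<omega>')))"
        unfolding \<Psi>_def
        by (rule nn_integral_eq_integral)
          (auto intro!: integrable_norm_sum_scaleR Q integrable_mult_right integrable_W)
      also have "\<dots> \<le> ennreal (norm (dcyl P m g h u (sample \<omega>)))"
        unfolding \<Psi>_def dcyl_eq by (rule ennreal_leI) (rule gaussian_vector_upper[OF Q])
      finally show "(\<integral>\<^sup>+\<omega>'. ennreal (norm (\<Psi> (sample \<omega>) (sample \<omega>'))) \<partial>M) \<le> ennreal (norm (dcyl P m g h u (sample \<omega>)))" .
    qed
    finally show ?thesis .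
  qed
  have "(\<integral>\<^sup>+x. ennreal (norm (cyl P g h u (sample (fst x)) - cyl P g h u (sample (snd x)))) \<partial>(M \<Otimes>\<^sub>M M))
      \<le> (\<integral>\<^sup>+x. \<integral>\<^sup>+\<theta>. ennreal (norm (\<Psi> (rot \<theta> x) (rot (\<theta> + pi / 2) x))) * indicator {0..pi / 2} \<theta> \<partial>lborel \<partial>(M \<Otimes>\<^sub>M M))"
    by (rule nn_integral_mono) (rule pathwise)
  also have "\<dots> = (\<integral>\<^sup>+\<theta>. \<integral>\<^sup>+x. ennreal (norm (\<Psi> (rot \<theta> x) (rot (\<theta> + pi / 2) x))) * indicator {0..pi / 2} \<theta> \<partial>(M \<Otimes>\<^sub>M M) \<partial>lborel)"
    using L.Fubini[OF joint] by simp
  also have "\<dots> = (\<integral>\<^sup>+\<theta>. (\<integral>\<^sup>+x. ennreal (norm (\<Psi> (sample (fst x)) (sample (snd x)))) \<partial>(M \<Otimes>\<^sub>M M)) * indicator {0..pi / 2} \<theta> \<partial>lborel)"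
  proof (rule nn_integral_cong)
    fix \<theta> :: real
    show "(\<integral>\<^sup>+x. ennreal (norm (\<Psi> (rot \<theta> x) (rot (\<theta> + pi / 2) x))) * indicator {0..pi / 2} \<theta> \<partial>(M \<Otimes>\<^sub>M M))
        = (\<integral>\<^sup>+x. ennreal (norm (\<Psi> (sample (fst x)) (sample (snd x)))) \<partial>(M \<Otimes>\<^sub>M M)) * indicator {0..pi / 2} \<theta>"
      by (cases "\<theta> \<in> {0..pi / 2}") (simp_all add: invariant)
  qed
  also have "\<dots> = ennreal (pi / 2) * (\<integral>\<^sup>+x. ennreal (norm (\<Psi> (sample (fst x)) (sample (snd x)))) \<partial>(M \<Otimes>\<^sub>M M))"
    by (subst nn_integral_cmult_indicator) (simp_all add: mult.commute)
  also have "\<dots> \<le> ennreal (pi / 2) * (\<integral>\<^sup>+\<omega>. ennreal (norm (dcyl P m g h u (sample \<omega>))) \<partial>M)"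
    by (rule mult_left_mono[OF gauss]) simp
  finally show ?thesis .
qed

lemma poincare_inequality:
  fixes u :: "'p \<Rightarrow> 'k::real_inner"
  assumes P: "finite P" and g: "\<And>p. p \<in> P \<Longrightarrow> C1_growth (m p) (g p)"
  shows "(LINT x|(M \<Otimes>\<^sub>M M). norm (cyl P g h u (sample (fst x)) - cyl P g h u (sample (snd x))))
    \<le> pi / 2 * (LINT \<omega>|M. norm (dcyl P m g h u (sample \<omega>)))"
  using poincare_inequality_nn[where P = P and m = m and g = g and h = h and u = u, OF P g]
    integrable_norm_dcyl[where P = P and m = m and g = g and h = h and u = u, OF P g]
    integrable_norm_cyl_diff_copies[where P = P and m = m and g = g and h = h and u = u, OF P g]
  by (simp add: nn_integral_eq_integral flip: ennreal_mult)

end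

section \<open>Interpolation of the first derivative\<close>

context isonormal
begin

lemma dcyl_diff_linear:
  assumes P: "finite P" and g: "\<And>p. p \<in> P \<Longrightarrow> C1_growth (m p) (g p)"
  shows "dcyl P m (\<lambda>p x. g p x - (\<Sum>i<m p. partial_deriv i (g p) (\<lambda>j. y (h p j)) * x i)) h u z
    = dcyl P m g h u z - dcyl P m g h u y"
  using P unfolding dcyl_def cyl_def
  by (auto simp: case_prod_unfold partial_deriv_diff_linear[OF g] scaleR_left_diff_distrib simp flip: sum_subtractf
      intro!: sum.cong)

text \<open>
  Subtracting from \<open>G\<close> the linear functional with the coefficients of the derivative at
  $\omega_0$ leaves a functional to which the Poincare inequality applies. The difference of the two is a
  Gaussian vector, whose oscillation bounds the norm of those coefficients from above.
\<close>
lemma derivative_at_point_bound: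
  fixes u :: "'p \<Rightarrow> 'k::real_inner"
  assumes P: "finite P" and g: "\<And>p. p \<in> P \<Longrightarrow> C1_growth (m p) (g p)"
  shows "sqrt (2 / pi) * norm (dcyl P m g h u (sample \<omega>\<^sub>0))
    \<le> 2 * (LINT \<omega>|M. norm (cyl P g h u (sample \<omega>)))
      + pi / 2 * (LINT \<omega>|M. norm (dcyl P m g h u (sample \<omega>) - dcyl P m g h u (sample \<omega>\<^sub>0)))"
proof -
  define a where "a = (\<lambda>(p, i). partial_deriv i (g p) (\<lambda>j. W (h p j) \<omega>\<^sub>0))"
  define g' where "g' p x = g p x - (\<Sum>i<m p. a (p, i) * x i)" for p x
  define Q where "Q = (SIGMA p:P. {..<m p})"
  have Q: "finite Q" using P by (auto simp: Q_def)
  have g': "C1_growth (m p) (g' p)" if "p \<in> P" for p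
    unfolding g'_def using g[OF that] by (rule C1_growth_diff_linear)
  have D': "dcyl P m g' h u (sample \<omega>) = dcyl P m g h u (sample \<omega>) - dcyl P m g h u (sample \<omega>\<^sub>0)" for \<omega>
    unfolding g'_def a_def prod.case by (rule dcyl_diff_linear[OF P g])
  let ?L = "\<lambda>x. \<Sum>q\<in>Q. (a q * (W (case q of (p, i) \<Rightarrow> h p i) (fst x) - W (case q of (p, i) \<Rightarrow> h p i) (snd x))) *\<^sub>R (case q of (p, i) \<Rightarrow> u p)"
  let ?dG = "\<lambda>x. cyl P g h u (sample (fst x)) - cyl P g h u (sample (snd x))"
  let ?dG' = "\<lambda>x. cyl P g' h u (sample (fst x)) - cyl P g' h u (sample (snd x))"
  \<comment> \<open>The difference of two samples of the linear functional that was subtracted.\<close>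
  have L: "?L x = ?dG x - ?dG' x" for x
  proof -
    have "?L x = (\<Sum>p\<in>P. \<Sum>i<m p. (a (p, i) * (W (h p i) (fst x) - W (h p i) (snd x))) *\<^sub>R u p)"
      using P by (simp add: Q_def sum.Sigma case_prod_unfold)
    also have "\<dots> = (\<Sum>p\<in>P. (\<Sum>i<m p. a (p, i) * W (h p i) (fst x) - a (p, i) * W (h p i) (snd x)) *\<^sub>R u p)"
      by (simp add: scaleR_sum_left right_diff_distrib)
    also have "\<dots> = ?dG x - ?dG' x"
      unfolding cyl_diff_copies sum_subtractf[symmetric]
      by (rule sum.cong[OF refl]) (simp add: g'_def sum_subtractf scaleR_left_diff_distrib[symmetric])
    finally show ?thesis .
  qed
  have iG: "integrable (M \<Otimes>\<^sub>M M) (\<lambda>x. norm (?dG x))" and iG': "integrable (M \<Otimes>\<^sub>M M) (\<lambda>x. norm (?dG' x))"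
    by (rule integrable_norm_cyl_diff_copies[where m = m], use P g g' in simp_all)+
  have iC: "integrable M (\<lambda>\<omega>. norm (cyl P g h u (sample \<omega>)))"
    by (rule integrable_norm_cyl[OF P g])
  note iC2 = integrable_fst_copy[OF iC] integrable_snd_copy[OF iC]
  have "sqrt (2 / pi) * norm (dcyl P m g h u (sample \<omega>\<^sub>0)) \<le> (LINT x|(M \<Otimes>\<^sub>M M). norm (?L x))"
    using gaussian_vector_lower[OF Q, of a "\<lambda>(p, i). h p i" "\<lambda>(p, i). u p"]
    by (simp add: dcyl_def cyl_def Q_def a_def case_prod_unfold)
  also have "\<dots> \<le> (LINT x|(M \<Otimes>\<^sub>M M). norm (?dG x) + norm (?dG' x))"
  proof (rule integral_mono)
    show "integrable (M \<Otimes>\<^sub>M M) (\<lambda>x. norm (?L x))"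
    proof (rule Bochner_Integration.integrable_bound[OF Bochner_Integration.integrable_add[OF iG iG']])
      show "(\<lambda>x. norm (?L x)) \<in> borel_measurable (M \<Otimes>\<^sub>M M)" by measurable
      show "AE x in M \<Otimes>\<^sub>M M. norm (norm (?L x)) \<le> norm (norm (?dG x) + norm (?dG' x))"
        unfolding L by (simp add: norm_triangle_ineq4)
    qed
  qed (use iG iG' in \<open>simp_all add: L norm_triangle_ineq4\<close>)
  also have "\<dots> = (LINT x|(M \<Otimes>\<^sub>M M). norm (?dG x)) + (LINT x|(M \<Otimes>\<^sub>M M). norm (?dG' x))"
    using iG iG' by simp
  also have "(LINT x|(M \<Otimes>\<^sub>M M). norm (?dG x))
      \<le> (LINT x|(M \<Otimes>\<^sub>M M). norm (cyl P g h u (sample (fst x))) + norm (cyl P g h u (sample (snd x))))"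
    using iG iC2 by (intro integral_mono) (auto simp: norm_triangle_ineq4)
  also have "\<dots> = 2 * (LINT \<omega>|M. norm (cyl P g h u (sample \<omega>)))"
    using iC2 integral_fst_copy[OF iC] integral_snd_copy[OF iC] by simp
  also have "(LINT x|(M \<Otimes>\<^sub>M M). norm (?dG' x)) \<le> pi / 2 * (LINT \<omega>|M. norm (dcyl P m g' h u (sample \<omega>)))"
    by (rule poincare_inequality[OF P g'])
  finally show ?thesis by (simp add: D')
qed

text \<open>
  Choose $\omega_0$ such that the derivative is close in mean to its value there. With $\pi < 4$, the
  constant is at most $4$ for the functional and $10$ for its second derivative.
\<close>
lemma first_derivative_bound:
  fixes u :: "'p \<Rightarrow> 'k::real_inner"
  assumes P: "finite P" and g: "\<And>p. p \<in> P \<Longrightarrow> smooth_growth (m p) (g p)"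
  shows "(LINT \<omega>|M. norm (dcyl P m g h u (sample \<omega>)))
    \<le> 10 * ((LINT \<omega>|M. norm (cyl P g h u (sample \<omega>)))
      + (LINT \<omega>|M. norm (dcyl (SIGMA p:P. {..<m p}) (\<lambda>(p, i). m p) (\<lambda>(p, i). partial_deriv i (g p)) (\<lambda>(p, i). h p)
          (\<lambda>(p, i). tensor_power [h p i] \<otimes> u p) (sample \<omega>))))"
proof -
  let ?Q = "SIGMA p:P. {..<m p}"
  let ?m2 = "\<lambda>(p, i). m p" and ?g2 = "\<lambda>(p, i). partial_deriv i (g p)" and ?h2 = "\<lambda>(p, i :: nat). h p"
    and ?u2 = "\<lambda>(p, i). tensor_power [h p i] \<otimes> u p"
  let ?D = "\<lambda>\<omega>. dcyl P m g h u (sample \<omega>)"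
  define d0 where "d0 = (LINT \<omega>|M. norm (cyl P g h u (sample \<omega>)))"
  define d2 where "d2 = (LINT \<omega>|M. norm (dcyl ?Q ?m2 ?g2 ?h2 ?u2 (sample \<omega>)))"
  have Q: "finite ?Q" using P by auto
  have g1: "C1_growth (m p) (g p)" if "p \<in> P" for p using g[OF that] by (rule smooth_growth_C1_growth)
  have g2: "C1_growth (?m2 q) (?g2 q)" if "q \<in> ?Q" for q
    using that g by (auto intro!: smooth_growth_C1_growth smooth_growth_partial_deriv)
  have D: "?D \<omega> = cyl ?Q ?g2 ?h2 ?u2 (sample \<omega>)" for \<omega> by (simp add: dcyl_def)
  have iDD: "integrable (M \<Otimes>\<^sub>M M) (\<lambda>x. norm (?D (fst x) - ?D (snd x)))"
    unfolding D by (rule integrable_norm_cyl_diff_copies[OF Q g2])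
  \<comment> \<open>Some value does not exceed the mean over all sample points, which the Poincare inequality bounds.\<close>
  obtain \<omega>\<^sub>0 where \<omega>\<^sub>0: "(LINT \<omega>|M. norm (?D \<omega> - ?D \<omega>\<^sub>0)) \<le> pi / 2 * d2"
  proof (rule ccontr)
    let ?E = "\<lambda>\<omega>'. LINT \<omega>|M. norm (?D \<omega> - ?D \<omega>')"
    assume "\<not> thesis"
    with that have *: "pi / 2 * d2 < ?E \<omega>'" for \<omega>' by (meson not_le)
    have "integrable M ?E" using two.integrable_snd[of "\<lambda>x y. norm (?D x - ?D y)"] iDD by (simp add: case_prod_unfold)
    moreover have "AE \<omega>' in M. pi / 2 * d2 < ?E \<omega>'" by (rule AE_I2) (rule *)
    ultimately have "pi / 2 * d2 < expectation ?E" by (rule expectation_greater)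
    also have "\<dots> = (LINT x|(M \<Otimes>\<^sub>M M). norm (?D (fst x) - ?D (snd x)))"
      using two.integral_snd[of "\<lambda>x y. norm (?D x - ?D y)"] iDD by (simp add: case_prod_unfold)
    also have "\<dots> \<le> pi / 2 * d2" unfolding D d2_def by (rule poincare_inequality[OF Q g2])
    finally show False by simp
  qed
  have iD: "integrable M (\<lambda>\<omega>. norm (?D \<omega>))" by (rule integrable_norm_dcyl[OF P g1])
  have iD0: "integrable M (\<lambda>\<omega>. norm (?D \<omega> - ?D \<omega>\<^sub>0))"
    using integrable_norm_dcyl[OF P C1_growth_diff_linear[OF g1], where h = h and u = u]
    by (simp only: dcyl_diff_linear[OF P g1, symmetric]) 
  have d: "0 \<le> d0" "0 \<le> d2" by (simp_all add: d0_def d2_def)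
  have "1 / 2 * norm (?D \<omega>\<^sub>0) \<le> sqrt (2 / pi) * norm (?D \<omega>\<^sub>0)"
  proof (rule mult_right_mono)
    show "1 / 2 \<le> sqrt (2 / pi)" using pi_less_4 by (intro real_le_rsqrt) (simp add: power2_eq_square field_simps)
  qed simp
  also have "\<dots> \<le> 2 * d0 + pi / 2 * (LINT \<omega>|M. norm (?D \<omega> - ?D \<omega>\<^sub>0))"
    unfolding d0_def by (rule derivative_at_point_bound[OF P g1])
  also have "\<dots> \<le> 2 * d0 + 2 * (2 * d2)"
    using pi_less_4 d by (intro add_mono mult_mono order_trans[OF \<omega>\<^sub>0]) auto
  finally have A: "norm (?D \<omega>\<^sub>0) \<le> 4 * d0 + 8 * d2" by simp
  have "(LINT \<omega>|M. norm (?D \<omega>)) \<le> (LINT \<omega>|M. norm (?D \<omega> - ?D \<omega>\<^sub>0) + norm (?D \<omega>\<^sub>0))"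
    using iD iD0 by (intro integral_mono) (auto simp: add.commute[of "norm (_ - _)"] norm_triangle_sub)
  also have "\<dots> = (LINT \<omega>|M. norm (?D \<omega> - ?D \<omega>\<^sub>0)) + norm (?D \<omega>\<^sub>0)"
    using iD0 by (simp add: prob_space)
  also have "\<dots> \<le> 2 * d2 + (4 * d0 + 8 * d2)"
    using pi_less_4 d by (intro add_mono A order_trans[OF \<omega>\<^sub>0] mult_right_mono) auto
  also have "\<dots> \<le> 10 * (d0 + d2)" using d by simp
  finally show ?thesis unfolding d0_def d2_def .
qed

end

section \<open>Malliavin derivatives of all orders\<close>

lemma inner_tensor_power_Cons:
  "tensor_power (h # hs) \<bullet> tensor_power (g # gs) = (h \<bullet> g) * (tensor_power hs \<bullet> tensor_power gs)"
  by (simp add: inner_tensor_power prod.lessThan_Suc_shift del: prod.lessThan_Suc)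

lemma inner_tensor_power_Nil: "tensor_power [] \<bullet> tensor_power [] = 1"
  by (simp add: inner_tensor_power)

lemma tensor_zero_left: "0 \<otimes> v = 0"
  by transfer simp

lemma tensor_sum_scaleR: "(\<Sum>i\<in>I. c i *\<^sub>R T i) \<otimes> v = (\<Sum>i\<in>I. c i *\<^sub>R (T i \<otimes> v))"
proof (induction I rule: infinite_finite_induct)
  case (insert i I)
  have "(c i *\<^sub>R T i + S) \<otimes> v = c i *\<^sub>R (T i \<otimes> v) + S \<otimes> v" for S
    by transfer (simp add: scaleR_left_distrib)
  with insert show ?case by simp
qed (simp_all add: tensor_zero_left)

definition multi_indices :: "nat \<Rightarrow> (nat \<Rightarrow> nat) \<Rightarrow> nat \<Rightarrow> (nat \<times> nat list) set" where
  "multi_indices J m l = (SIGMA j:{..<J}. {is. set is \<subseteq> {..<m j} \<and> length is = l})"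

lemma finite_multi_indices: "finite (multi_indices J m l)"
  unfolding multi_indices_def by (intro finite_SigmaI finite_lists_length_eq) auto

lemma bij_betw_multi_indices_Suc:
  "bij_betw (\<lambda>((j, is), i). (j, i # is)) (SIGMA p:multi_indices J m l. {..<m (fst p)}) (multi_indices J m (Suc l))"
  unfolding bij_betw_def
proof
  show "inj_on (\<lambda>((j, is), i). (j, i # is)) (SIGMA p:multi_indices J m l. {..<m (fst p)})"
    by (auto simp: inj_on_def)
  show "(\<lambda>((j, is), i). (j, i # is)) ` (SIGMA p:multi_indices J m l. {..<m (fst p)}) = multi_indices J m (Suc l)"
  proof (intro equalityI subsetI)
    fix q assume "q \<in> multi_indices J m (Suc l)"
    then obtain j i "is" where "q = (j, i # is)" "j < J" "i < m j" "set is \<subseteq> {..<m j}" "length is = l"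
      by (auto simp: multi_indices_def length_Suc_conv)
    then show "q \<in> (\<lambda>((j, is), i). (j, i # is)) ` (SIGMA p:multi_indices J m l. {..<m (fst p)})"
      by (intro image_eqI[of _ _ "((j, is), i)"]) (auto simp: multi_indices_def)
  qed (auto simp: multi_indices_def)
qed

lemma bij_betw_map_prod_Sigma:
  assumes \<pi>: "bij_betw \<pi> A B" and C: "\<And>a. a \<in> A \<Longrightarrow> C (\<pi> a) = D a"
  shows "bij_betw (map_prod \<pi> id) (Sigma A D) (Sigma B C)"
proof -
  have "inj_on (map_prod \<pi> id) (Sigma A D)"
    using bij_betw_imp_inj_on[OF \<pi>] by (auto simp: inj_on_def)
  moreover have "map_prod \<pi> id ` Sigma A D = Sigma B C"
  proof (intro equalityI subsetI)
    fix x assume "x \<in> Sigma B C"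
    then obtain a i where "x = (\<pi> a, i)" "a \<in> A" "i \<in> C (\<pi> a)"
      using bij_betw_imp_surj_on[OF \<pi>] by auto
    then show "x \<in> map_prod \<pi> id ` Sigma A D" using C by (intro image_eqI[of _ _ "(a, i)"]) auto
  qed (use C bij_betw_apply[OF \<pi>] in auto)
  ultimately show ?thesis by (simp add: bij_betw_def)
qed

text \<open>
  The \<open>l\<close>-th derivative of $\sum_j f_j(W(h_{j,0}), W(h_{j,1}), \dots)\,v_j$, as a functional of the form \<open>cyl\<close>
  with one summand for each \<open>j\<close> and each list of \<open>l\<close> directions. Order 0 is included, so that all orders obey
  the same recursion.
\<close>
definition iterated_deriv ::
    "nat \<Rightarrow> (nat \<Rightarrow> nat) \<Rightarrow> (nat \<Rightarrow> (nat \<Rightarrow> real) \<Rightarrow> real) \<Rightarrow> (nat \<Rightarrow> nat \<Rightarrow> 'h::{real_inner, second_countable_topology})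
      \<Rightarrow> (nat \<Rightarrow> 'v::real_inner) \<Rightarrow> nat \<Rightarrow> ('h \<Rightarrow> real) \<Rightarrow> ('h list, 'v) ell2" where
  "iterated_deriv J m f h v l = cyl (multi_indices J m l) (\<lambda>(j, is). partial_derivs is (f j)) (\<lambda>(j, is). h j)
      (\<lambda>(j, is). tensor_power (map (h j) is) \<otimes> v j)"

lemma norm_iterated_deriv_0:
  "norm (iterated_deriv J m f h v 0 z) = norm (\<Sum>j<J. f j (\<lambda>i. z (h j i)) *\<^sub>R v j)"
proof -
  have "bij_betw (\<lambda>j. (j, [])) {..<J} (multi_indices J m 0)"
    by (auto simp: bij_betw_def inj_on_def multi_indices_def)
  then show ?thesis unfolding iterated_deriv_def cyl_def
    by (rule norm_sum_scaleR_reindex[symmetric]) (auto simp: partial_derivs_def inner_tensor inner_tensor_power)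
qed

text \<open>
  Differentiating the \<open>l\<close>-th derivative yields values in $H \otimes (H^{\otimes l} \otimes V)$, and the next
  derivative has values in $H^{\otimes (l+1)} \otimes V$. The summands correspond to each other with equal inner products.
\<close>
lemma norm_dcyl_iterated_deriv:
  "norm (dcyl (multi_indices J m l) (\<lambda>(j, is). m j) (\<lambda>(j, is). partial_derivs is (f j)) (\<lambda>(j, is). h j)
      (\<lambda>(j, is). tensor_power (map (h j) is) \<otimes> v j) z)
    = norm (iterated_deriv J m f h v (Suc l) z)"
  unfolding dcyl_def iterated_deriv_def cyl_def case_prod_unfold
  by (rule norm_sum_scaleR_reindex[OF bij_betw_multi_indices_Suc])
    (auto simp: partial_derivs_Cons inner_tensor_single inner_tensor inner_tensor_power_Cons inner_tensor_power_Nil)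

lemma norm_dcyl_dcyl_iterated_deriv:
  "norm (dcyl (SIGMA p:multi_indices J m l. {..<(\<lambda>(j, is). m j) p}) (\<lambda>(p, i). (\<lambda>(j, is). m j) p)
      (\<lambda>(p, i). partial_deriv i ((\<lambda>(j, is). partial_derivs is (f j)) p)) (\<lambda>(p, i). (\<lambda>(j, is). h j) p)
      (\<lambda>(p, i). tensor_power [(\<lambda>(j, is). h j) p i] \<otimes> (\<lambda>(j, is). tensor_power (map (h j) is) \<otimes> v j) p) z)
    = norm (iterated_deriv J m f h v (Suc (Suc l)) z)"
proof -
  let ?\<pi> = "\<lambda>((j, is), i). (j, i # is)"
  let ?A = "\<lambda>l. SIGMA p:multi_indices J m l. {..<m (fst p)}"
  have "bij_betw (map_prod ?\<pi> id) (SIGMA q:?A l. {..<m (fst (fst q))}) (?A (Suc l))"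
    by (rule bij_betw_map_prod_Sigma[OF bij_betw_multi_indices_Suc]) auto
  from bij_betw_trans[OF this bij_betw_multi_indices_Suc]
  have bij: "bij_betw (?\<pi> \<circ> map_prod ?\<pi> id) (SIGMA q:?A l. {..<m (fst (fst q))}) (multi_indices J m (Suc (Suc l)))" .
  show ?thesis
    unfolding dcyl_def iterated_deriv_def cyl_def case_prod_unfold
    by (rule norm_sum_scaleR_reindex[OF bij[unfolded case_prod_unfold]])
      (auto simp: partial_derivs_Cons inner_tensor_single inner_tensor inner_tensor_power_Cons inner_tensor_power_Nil)
qed

context isonormal
begin

text \<open>
  The representations selected in the definition of the Malliavin derivative are the same for all
  orders, so one family of functions describes the derivatives of all orders simultaneously.
\<close>
lemma malliavin_iterated_deriv:
  fixes F :: "'w \<Rightarrow> 'v::{real_inner, second_countable_topology}"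
  assumes "F \<in> smooth_vec_rv M W"
  obtains J m f h v where "\<And>j. j < J \<Longrightarrow> smooth_growth (m j) (f j)"
    and "AE \<omega> in M. F \<omega> = (\<Sum>j<J. f j (\<lambda>i. W (h j i) \<omega>) *\<^sub>R v j)"
    and "\<And>l \<omega>. malliavin M W l F \<omega> = iterated_deriv J m f h v l (sample \<omega>)"
proof -
  obtain J G v where rep: "(SOME r. r \<in> smooth_vec_reps M W F) = (J, G, v)"
    by (cases "SOME r. r \<in> smooth_vec_reps M W F") auto
  have "(J, G, v) \<in> smooth_vec_reps M W F"
    unfolding rep[symmetric] by (rule someI_ex) (use assms in \<open>auto simp: smooth_vec_rv_def\<close>)
  then have G: "\<And>j. j < J \<Longrightarrow> G j \<in> smooth_rv M W" and F: "AE \<omega> in M. F \<omega> = (\<Sum>j<J. G j \<omega> *\<^sub>R v j)"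
    by (auto simp: smooth_vec_reps_def)
  define r where "r j = (SOME r. r \<in> cylinder_reps M W (G j))" for j
  define m where "m j = fst (r j)" for j
  define f where "f j = fst (snd (r j))" for j
  define h where "h j = snd (snd (r j))" for j
  have r: "r j = (m j, f j, h j)" for j by (simp add: m_def f_def h_def)
  have rj: "(m j, f j, h j) \<in> cylinder_reps M W (G j)" if "j < J" for j
    unfolding r[symmetric] r_def by (rule someI_ex) (use G[OF that] in \<open>auto simp: smooth_rv_def\<close>)
  show thesis
  proof
    show "smooth_growth (m j) (f j)" if "j < J" for j
      using rj[OF that] by (auto simp: cylinder_reps_def smooth_growth_def)
    have "AE \<omega> in M. \<forall>j\<in>{..<J}. G j \<omega> = f j (\<lambda>i. W (h j i) \<omega>)"
      using rj by (intro AE_finite_allI) (auto simp: cylinder_reps_def)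
    with F show "AE \<omega> in M. F \<omega> = (\<Sum>j<J. f j (\<lambda>i. W (h j i) \<omega>) *\<^sub>R v j)"
      by eventually_elim simp
    show "malliavin M W l F \<omega> = iterated_deriv J m f h v l (sample \<omega>)" for l \<omega>
    proof -
      have "malliavin M W l F \<omega> = (\<Sum>j<J. malliavin_real M W l (G j) \<omega> \<otimes> v j)"
        by (simp add: malliavin_def rep)
      also have "\<dots> = (\<Sum>j<J. \<Sum>is\<in>{is. set is \<subseteq> {..<m j} \<and> length is = l}.
          partial_derivs is (f j) (\<lambda>i. W (h j i) \<omega>) *\<^sub>R (tensor_power (map (h j) is) \<otimes> v j))"
        by (simp add: malliavin_real_def r_def[symmetric] r tensor_sum_scaleR)
      also have "\<dots> = iterated_deriv J m f h v l (sample \<omega>)"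
        unfolding iterated_deriv_def multi_indices_def
        by (subst cyl_Sigma) (simp_all add: finite_lists_length_eq)
      finally show ?thesis .
    qed
  qed
qed

lemma L1_norm_malliavin_facts:
  fixes F :: "'w \<Rightarrow> 'v::{real_inner, second_countable_topology}"
  assumes F: "F \<in> smooth_vec_rv M W"
  shows "L1_norm M (malliavin M W 0 F) = L1_norm M F"
    and "L1_norm M (malliavin M W (Suc l) F)
      \<le> 10 * (L1_norm M (malliavin M W l F) + L1_norm M (malliavin M W (Suc (Suc l)) F))"
proof -
  obtain J m f h v where f: "\<And>j. j < J \<Longrightarrow> smooth_growth (m j) (f j)"
    and AE: "AE \<omega> in M. F \<omega> = (\<Sum>j<J. f j (\<lambda>i. W (h j i) \<omega>) *\<^sub>R v j)"
    and D: "\<And>l \<omega>. malliavin M W l F \<omega> = iterated_deriv J m f h v l (sample \<omega>)"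
    using malliavin_iterated_deriv[OF F] by blast
  have C1: "C1_growth (m j) (f j)" if "j < J" for j using f[OF that] by (rule smooth_growth_C1_growth)
  have [measurable]: "F \<in> borel_measurable M" using F by (simp add: smooth_vec_rv_def)
  have "(\<lambda>\<omega>. norm (\<Sum>j<J. f j (\<lambda>i. W (h j i) \<omega>) *\<^sub>R v j)) \<in> borel_measurable M"
    using integrable_norm_cyl[of "{..<J}" m f h v] C1 by (auto simp: cyl_def)
  then show "L1_norm M (malliavin M W 0 F) = L1_norm M F"
    unfolding L1_norm_def D norm_iterated_deriv_0
    by (intro integral_cong_AE) (use AE in auto)
  let ?P = "multi_indices J m l"
  have g: "smooth_growth ((\<lambda>(j, is). m j) p) ((\<lambda>(j, is). partial_derivs is (f j)) p)" if "p \<in> ?P" for p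
    using that f by (auto simp: multi_indices_def intro: smooth_growth_partial_derivs)
  show "L1_norm M (malliavin M W (Suc l) F)
      \<le> 10 * (L1_norm M (malliavin M W l F) + L1_norm M (malliavin M W (Suc (Suc l)) F))"
    using first_derivative_bound[where P = ?P and m = "\<lambda>(j, is). m j" and g = "\<lambda>(j, is). partial_derivs is (f j)" and h = "\<lambda>(j, is). h j"
        and u = "\<lambda>(j, is). tensor_power (map (h j) is) \<otimes> v j", OF finite_multi_indices g]
    unfolding L1_norm_def D norm_dcyl_iterated_deriv norm_dcyl_dcyl_iterated_deriv
    by (simp only: iterated_deriv_def)
qed

end

section \<open>Comparison of the norms\<close>

text \<open>
  Each even index is adjacent to at most two odd ones.
\<close>
lemma odd_terms_bound:
  fixes N :: "nat \<Rightarrow> real"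
  assumes nonneg: "\<And>l. 0 \<le> N l" and c: "0 \<le> c" and step: "\<And>l. N (Suc l) \<le> c * (N l + N (Suc (Suc l)))"
  shows "(\<Sum>l<n. N (2 * l + 1)) \<le> 2 * c * (\<Sum>l\<le>n. N (2 * l))"
proof -
  have "(\<Sum>l<n. N (2 * l + 1)) \<le> (\<Sum>l<n. c * (N (2 * l) + N (2 * Suc l)))"
    using step[of "2 * _"] by (intro sum_mono) simp
  also have "\<dots> = c * ((\<Sum>l<n. N (2 * l)) + (\<Sum>l<n. N (2 * Suc l)))"
    by (simp add: sum_distrib_left sum.distrib distrib_left)
  also have "\<dots> \<le> c * ((\<Sum>l\<le>n. N (2 * l)) + (\<Sum>l\<le>n. N (2 * l)))"
  proof (intro mult_left_mono add_mono c)
    show "(\<Sum>l<n. N (2 * l)) \<le> (\<Sum>l\<le>n. N (2 * l))" using nonneg by (intro sum_mono2) auto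
    have "(\<Sum>l<n. N (2 * Suc l)) \<le> N 0 + (\<Sum>l<n. N (2 * Suc l))" using nonneg by simp
    also have "\<dots> = (\<Sum>l\<le>n. N (2 * l))" by (simp only: lessThan_Suc_atMost[symmetric] sum.lessThan_Suc_shift) simp
    finally show "(\<Sum>l<n. N (2 * Suc l)) \<le> (\<Sum>l\<le>n. N (2 * l))" .
  qed
  finally show ?thesis by simp
qed

lemma even_terms_bound:
  fixes N :: "nat \<Rightarrow> real"
  assumes nonneg: "\<And>l. 0 \<le> N l" and c: "0 \<le> c" and step: "\<And>l. N (Suc l) \<le> c * (N l + N (Suc (Suc l)))"
  shows "(\<Sum>l=1..n. N (2 * l)) \<le> 2 * c * (\<Sum>l=0..n. N (2 * l + 1))"
  using odd_terms_bound[of "\<lambda>l. N (Suc l)" c n] assms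
  by (simp add: sum.atLeast1_atMost_eq atMost_atLeast0)

lemma eta_ge: "10 \<le> eta"
proof -
  have "1 \<le> sqrt (2 * exp 1)" using exp_ge_add_one_self[of 1] by (intro real_le_rsqrt) simp
  then show ?thesis using pi_gt_zero unfolding eta_def by linarith
qed

lemma sum_split_parity:
  fixes N :: "nat \<Rightarrow> real"
  shows "(\<Sum>l\<le>2 * a. N l) = (\<Sum>l\<le>a. N (2 * l)) + (\<Sum>l<a. N (2 * l + 1))"
  by (induction a) simp_all

text \<open>
  The terms missing on the right have indices of one parity and are bounded by
  \<open>odd_terms_bound\<close> or \<open>even_terms_bound\<close>. Where the sum on the right does not contain a
  neighbour at an end of the range, \<open>N 0\<close> or \<open>N k\<close> supplies it.
\<close>
lemma interpolated_sums:
  fixes N :: "nat \<Rightarrow> real"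
  assumes nonneg: "\<And>l. 0 \<le> N l" and c: "0 \<le> c" and step: "\<And>l. N (Suc l) \<le> c * (N l + N (Suc (Suc l)))"
    and k: "1 \<le> k"
  shows "(\<Sum>l\<le>k. N l) \<le> (1 + 2 * c) * (N 0 + N k + (\<Sum>l = 1..nat \<lceil>real k / 2\<rceil> - 1. N (2 * l)))" (is ?even)
    and "(\<Sum>l\<le>k. N l) \<le> (1 + 2 * c) * (N 0 + N k + (\<Sum>l = 1..nat \<lfloor>real k / 2\<rfloor>. N (2 * l - 1)))" (is ?odd)
proof -
  note odd = odd_terms_bound[where N = N, OF nonneg c step] and even = even_terms_bound[where N = N, OF nonneg c step]
  have from0: "(\<Sum>l\<le>a. N (2 * l)) = N 0 + (\<Sum>l=1..a. N (2 * l))" for a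
    by (simp add: sum.atMost_shift sum.atLeast1_atMost_eq)
  have odds: "(\<Sum>l=1..a. N (2 * l - 1)) = (\<Sum>l<a. N (2 * l + 1))" for a
    by (simp add: sum.atLeast1_atMost_eq)
  have expand: "(1 + 2 * c) * x = x + 2 * c * x" for x by (simp add: distrib_right)
  have mono: "2 * c * x \<le> 2 * c * y" if "x \<le> y" for x y using that c by (simp add: mult_left_mono)
  show ?even
  proof (cases "even k")
    case True
    then obtain b where b: "k = 2 * Suc b" using k by (metis One_nat_def dvd_def mult_eq_0_iff not0_implies_Suc not_one_le_zero)
    have "real k / 2 = real (Suc b)" by (simp add: b)
    then have "nat \<lceil>real k / 2\<rceil> - 1 = b" by (simp only: ceiling_of_nat nat_int diff_Suc_1)
    moreover have "(\<Sum>l\<le>Suc b. N (2 * l)) = N 0 + N k + (\<Sum>l=1..b. N (2 * l))"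
      using from0[of b] by (simp add: b)
    ultimately show ?thesis
      using odd[of "Suc b"] unfolding expand by (simp only: b sum_split_parity)
  next
    case False
    then obtain a where a: "k = 2 * a + 1" by (elim oddE)
    have "\<lceil>real k / 2\<rceil> = int a + 1" by (rule ceiling_unique) (simp_all add: a)
    then have n: "nat \<lceil>real k / 2\<rceil> - 1 = a" by simp
    have "(\<Sum>l\<le>k. N l) = (\<Sum>l\<le>a. N (2 * l)) + (\<Sum>l<a. N (2 * l + 1)) + N k"
      using sum_split_parity[of N a] by (simp add: a)
    moreover have "(\<Sum>l<a. N (2 * l + 1)) \<le> 2 * c * (N 0 + N k + (\<Sum>l=1..a. N (2 * l)))"
      by (rule order_trans[OF odd mono]) (use nonneg[of k] in \<open>simp add: from0\<close>)
    ultimately show ?thesis unfolding expand n from0 by linarith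
  qed
  show ?odd
  proof (cases "even k")
    case True
    then obtain b where b: "k = 2 * Suc b" using k by (metis One_nat_def dvd_def mult_eq_0_iff not0_implies_Suc not_one_le_zero)
    have "real k / 2 = real (Suc b)" by (simp add: b)
    then have n: "nat \<lfloor>real k / 2\<rfloor> = Suc b" by (simp only: floor_of_nat nat_int)
    have "(\<Sum>l\<le>k. N l) = N 0 + N k + (\<Sum>l=1..b. N (2 * l)) + (\<Sum>l<Suc b. N (2 * l + 1))"
      using from0[of b] by (simp only: b sum_split_parity) simp
    moreover have "(\<Sum>l=1..b. N (2 * l)) \<le> 2 * c * (N 0 + N k + (\<Sum>l<Suc b. N (2 * l + 1)))"
      by (rule order_trans[OF even mono])
        (use nonneg[of k] nonneg[of 0] in \<open>simp add: atLeast0AtMost lessThan_Suc_atMost\<close>)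
    ultimately show ?thesis unfolding expand n odds by linarith
  next
    case False
    then obtain a where a: "k = 2 * a + 1" by (elim oddE)
    have "\<lfloor>real k / 2\<rfloor> = int a" by (rule floor_unique) (simp_all add: a)
    then have n: "nat \<lfloor>real k / 2\<rfloor> = a" by simp
    have "(\<Sum>l\<le>k. N l) = N 0 + N k + (\<Sum>l=1..a. N (2 * l)) + (\<Sum>l<a. N (2 * l + 1))"
      using sum_split_parity[of N a] from0[of a] by (simp add: a)
    moreover have "(\<Sum>l=1..a. N (2 * l)) \<le> 2 * c * (N 0 + N k + (\<Sum>l<a. N (2 * l + 1)))"
      by (rule order_trans[OF even mono])
        (use nonneg[of 0] in \<open>simp add: a atLeast0AtMost flip: lessThan_Suc_atMost\<close>)
    ultimately show ?thesis unfolding expand n odds by linarith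
  qed
qed

theorem corollary2p3:
  fixes M :: "'w measure"
    and W :: "'h::{real_inner, complete_space, second_countable_topology} \<Rightarrow> 'w \<Rightarrow> real"
  assumes isonormal: "isonormal_process M W"
    and generated: "sets M = sigma_sets (space M) {W h -` A \<inter> space M | h A. A \<in> sets borel}"
  shows
    "(\<forall>F :: 'w \<Rightarrow> 'v::{real_inner, complete_space, second_countable_topology}.
        F \<in> smooth_vec_rv M W \<longrightarrow>
          graph_norm M W 2 F \<le> sobolev_norm M W 2 F \<and>
          sobolev_norm M W 2 F \<le> (1 + eta) * graph_norm M W 2 F)
     \<and>
     (\<forall>k::nat. 3 \<le> k \<longrightarrow>
       (\<forall>F :: 'w \<Rightarrow> 'v. F \<in> smooth_vec_rv M W \<longrightarrow>
          sobolev_norm M W k F \<le> (1 + 2 * eta) * (graph_norm M W k F +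
            (\<Sum>l = 1 .. nat \<lceil>real k / 2\<rceil> - 1. L1_norm M (malliavin M W (2 * l) F))) \<and>
          sobolev_norm M W k F \<le> (1 + 2 * eta) * (graph_norm M W k F +
            (\<Sum>l = 1 .. nat \<lfloor>real k / 2\<rfloor>. L1_norm M (malliavin M W (2 * l - 1) F)))))"
proof -
  interpret isonormal M W using isonormal by unfold_locales
  have eta0: "0 \<le> eta" using eta_ge by simp
  have "graph_norm M W 2 F \<le> sobolev_norm M W 2 F \<and> sobolev_norm M W 2 F \<le> (1 + eta) * graph_norm M W 2 F
      \<and> (\<forall>k\<ge>3. sobolev_norm M W k F \<le> (1 + 2 * eta) * (graph_norm M W k F +
            (\<Sum>l = 1 .. nat \<lceil>real k / 2\<rceil> - 1. L1_norm M (malliavin M W (2 * l) F))) \<and>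
          sobolev_norm M W k F \<le> (1 + 2 * eta) * (graph_norm M W k F +
            (\<Sum>l = 1 .. nat \<lfloor>real k / 2\<rfloor>. L1_norm M (malliavin M W (2 * l - 1) F))))"
    if F: "F \<in> smooth_vec_rv M W" for F :: "'w \<Rightarrow> 'v"
  proof -
    define N where "N l = L1_norm M (malliavin M W l F)" for l
    have nonneg: "0 \<le> N l" for l by (simp add: N_def L1_norm_def)
    have step: "N (Suc l) \<le> eta * (N l + N (Suc (Suc l)))" for l
    proof -
      have "N (Suc l) \<le> 10 * (N l + N (Suc (Suc l)))"
        unfolding N_def by (rule L1_norm_malliavin_facts(2)[OF F])
      also have "\<dots> \<le> eta * (N l + N (Suc (Suc l)))"
        using nonneg by (intro mult_right_mono eta_ge) auto
      finally show ?thesis .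
    qed
    have graph: "graph_norm M W k F = N 0 + N k" for k
      by (simp add: graph_norm_def N_def L1_norm_malliavin_facts(1)[OF F])
    have sobolev: "sobolev_norm M W k F = (\<Sum>l\<le>k. N l)" for k
    proof -
      have "(\<Sum>l\<le>k. N l) = N 0 + (\<Sum>l=1..k. N l)"
        by (simp add: sum.atMost_shift sum.atLeast1_atMost_eq)
      then show ?thesis by (simp add: sobolev_norm_def N_def L1_norm_malliavin_facts(1)[OF F])
    qed
    have two: "(\<Sum>l\<le>2. N l) = N 0 + N 1 + N 2" by (simp add: numeral_2_eq_2)
    have "N 1 \<le> eta * (N 0 + N 2)" using step[of 0] by (simp add: numeral_2_eq_2)
    then show ?thesis
      using interpolated_sums[where N = N, OF nonneg eta0 step] nonneg[of 1]
      unfolding graph sobolev two N_def[symmetric] by (simp add: distrib_right)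
  qed
  then show ?thesis by blast
qed

end
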